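(* Let $(G,\alpha_G)$ and $(H,\alpha_H)$ be Hom-Lie algebras with compatible Hom-actions on each other, and let $(K,\alpha_K)$ be a Hom-ideal of both $(G,\alpha_G)$ and $(H,\alpha_H)$. Let $K_1$ be the image of the homomorphism $K\star H\to G\star H$, $k\star h\mapsto k\star h$, and $K_2$ the image of the homomorphism $G\star K\to G\star H$, $g\star k\mapsto g\star k$. Then there is an isomorphism of Hom-Lie algebras \[\phi:\left(\frac GK,\overline\alpha_G\right)\star\left(\frac HK,\overline\alpha_H\right)\overset{\cong}{\longrightarrow}\left(\frac{G\star H}{K_1+K_2},\overline\alpha_{G\star H}\right)\] defined by $\phi\big((g+K)\star(h+K)\big)=g\star h+(K_1+K_2)$, where $\overline\alpha$ denotes the endomorphism induced by $\alpha$ on the quotient.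
   Context: Fix a ground field $\mathbb K$; all vector spaces and (bi)linear maps are over $\mathbb K$. A Hom-Lie algebra $(L,\alpha_L)$ is a vector space $L$ with a bilinear bracket and a linear map $\alpha_L:L\to L$ such that $[x,y]=-[y,x]$ and $[\alpha_L(x),[y,z]]+[\alpha_L(z),[x,y]]+[\alpha_L(y),[z,x]]=0$; all Hom-Lie algebras are assumed multiplicative: $\alpha_L[x,y]=[\alpha_L(x),\alpha_L(y)]$. Homomorphisms are linear maps preserving brackets and commuting with the endomorphisms $\alpha$. A Hom-ideal $(H,\alpha_{L|})$ of $(L,\alpha_L)$ is a subspace $H$ with $\alpha_L(H)\subseteq H$ and $[h,x]\in H$ for all $h\in H$, $x\in L$; its endomorphism is the restriction of $\alpha_L$. A Hom-action of $(L,\alpha_L)$ on $(M,\alpha_M)$ is a linear map $L\otimes M\to M$, $x\otimes m\mapsto {}^xm$, with ${}^{[x,y]}\alpha_M(m)={}^{\alpha_L(x)}({}^ym)-{}^{\alpha_L(y)}({}^xm)$, ${}^{\alpha_L(x)}[m,m']=[{}^xm,\alpha_M(m')]+[\alpha_M(m),{}^xm']$, $\alpha_M({}^xm)={}^{\alpha_L(x)}\alpha_M(m)$. Mutual Hom-actions of $(M,\alpha_M)$ and $(N,\alpha_N)$ are compatible if ${}^{({}^mn)}m'=[m',{}^nm]$ and ${}^{({}^nm)}n'=[n',{}^mn]$ for all $m,m'\in M$, $n,n'\in N$. For compatible mutual Hom-actions, the non-abelian tensor product $(M\star N,\alpha_{M\star N})$ is the quotient of the vector space $M\otimes N$ by the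 subspace spanned by all elements: (i) $[m,m']\otimes\alpha_N(n)-\alpha_M(m)\otimes{}^{m'}n+\alpha_M(m')\otimes{}^mn$; (ii) $\alpha_M(m)\otimes[n,n']-{}^{n'}m\otimes\alpha_N(n)+{}^nm\otimes\alpha_N(n')$; (iii) ${}^nm\otimes{}^mn$; (iv) ${}^nm\otimes{}^{m'}n'+{}^{n'}m'\otimes{}^mn$; (v) $[{}^nm,{}^{n'}m']\otimes\alpha_N({}^{m''}n'')+[{}^{n'}m',{}^{n''}m'']\otimes\alpha_N({}^mn)+[{}^{n''}m'',{}^nm]\otimes\alpha_N({}^{m'}n')$. The class of $m\otimes n$ is $m\star n$; the bracket is $[m\star n,m'\star n']=-{}^nm\star{}^{m'}n'$, and $\alpha_{M\star N}(m\star n)=\alpha_M(m)\star\alpha_N(n)$. It is understood in the setting that the Hom-actions between $G$ and $H$ restrict to compatible mutual Hom-actions of $K$ and $H$ and of $G$ and $K$, and induce compatible mutual Hom-actions of $G/K$ and $H/K$, so that all tensor products in the claim are defined; then $K_1$ and $K_2$ are Hom-ideals of $G\star H$. (For example, this is the case when $G,H,K$ are all Hom-ideals of one Hom-Lie algebra, acting by the bracket, with $K\subseteq G\cap H$.)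
   Formalization: Over a ground field of characteristic 2 the bracket on the non-abelian tensor product can fail to be well defined; in that case only, it is assumed that the brackets on G⋆H, K⋆H and G⋆K are well defined. *)

theory Defs
  imports "HOL-Algebra.Module" "HOL-Algebra.AbelCoset" "HOL.Hull"
begin

text \<open>
  Vector spaces over a field \<open>R\<close> are modules over \<open>R\<close> in the sense of \<open>HOL-Algebra\<close>. The fields
  \<open>mult\<close> and \<open>one\<close> that module records inherit from ring records carry no meaning here.
\<close>

section \<open>Linear algebra: linear maps, spans, quotients, tensor products\<close>

definition linear_map where
  "linear_map R V W f \<longleftrightarrow>
     f \<in> carrier V \<rightarrow> carrier W \<and>
     (\<forall>x\<in>carrier V. \<forall>y\<in>carrier V. f (x \<oplus>\<^bsub>V\<^esub> y) = f x \<oplus>\<^bsub>W\<^esub> f y) \<and>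
     (\<forall>c\<in>carrier R. \<forall>x\<in>carrier V. f (c \<odot>\<^bsub>V\<^esub> x) = c \<odot>\<^bsub>W\<^esub> f x)"

definition bilinear_map where
  "bilinear_map R U V W f \<longleftrightarrow>
     (\<forall>x\<in>carrier U. linear_map R V W (\<lambda>y. f x y)) \<and>
     (\<forall>y\<in>carrier V. linear_map R U W (\<lambda>x. f x y))"

definition subspace_span where
  "subspace_span R V S = (\<lambda>W. submodule W R V) hull S"

text \<open>
  In quotients, an operation is the union over all representatives, as in \<^const>\<open>set_mult\<close>:
  it is a single coset exactly if the result does not depend on the representatives.
\<close>

definition quotient_module ::
    "('k, 'a, 'z) module_scheme \<Rightarrow> 'a set \<Rightarrow> ('k, 'a set) module" where
  "quotient_module V W =
     \<lparr>carrier = a_rcosets\<^bsub>V\<^esub> W, mult = undefined, one = undefined,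
      zero = W, add = (<+>\<^bsub>V\<^esub>),
      smult = (\<lambda>c X. \<Union>x\<in>X. W +>\<^bsub>V\<^esub> (c \<odot>\<^bsub>V\<^esub> x))\<rparr>"

definition free_module :: "('k, 'r) ring_scheme \<Rightarrow> 'x set \<Rightarrow> ('k, 'x \<Rightarrow> 'k) module" where
  "free_module R X =
     \<lparr>carrier = {f. range f \<subseteq> carrier R \<and> finite {x. f x \<noteq> \<zero>\<^bsub>R\<^esub>} \<and> {x. f x \<noteq> \<zero>\<^bsub>R\<^esub>} \<subseteq> X},
      mult = undefined, one = undefined,
      zero = (\<lambda>_. \<zero>\<^bsub>R\<^esub>), add = (\<lambda>f g x. f x \<oplus>\<^bsub>R\<^esub> g x),
      smult = (\<lambda>c f x. c \<otimes>\<^bsub>R\<^esub> f x)\<rparr>"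

definition free_basis :: "('k, 'r) ring_scheme \<Rightarrow> 'x \<Rightarrow> 'x \<Rightarrow> 'k" where
  "free_basis R x = (\<lambda>y. if y = x then \<one>\<^bsub>R\<^esub> else \<zero>\<^bsub>R\<^esub>)"

definition tensor_kernel where
  "tensor_kernel R M N =
     (let F = free_module R (carrier M \<times> carrier N);
          e = (\<lambda>m n. free_basis R (m, n))
      in subspace_span R F
        ({e (m \<oplus>\<^bsub>M\<^esub> m') n \<ominus>\<^bsub>F\<^esub> (e m n \<oplus>\<^bsub>F\<^esub> e m' n) | m m' n.
            m \<in> carrier M \<and> m' \<in> carrier M \<and> n \<in> carrier N} \<union>
         {e m (n \<oplus>\<^bsub>N\<^esub> n') \<ominus>\<^bsub>F\<^esub> (e m n \<oplus>\<^bsub>F\<^esub> e m n') | m n n'.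
            m \<in> carrier M \<and> n \<in> carrier N \<and> n' \<in> carrier N} \<union>
         {e (c \<odot>\<^bsub>M\<^esub> m) n \<ominus>\<^bsub>F\<^esub> c \<odot>\<^bsub>F\<^esub> e m n | c m n.
            c \<in> carrier R \<and> m \<in> carrier M \<and> n \<in> carrier N} \<union>
         {e m (c \<odot>\<^bsub>N\<^esub> n) \<ominus>\<^bsub>F\<^esub> c \<odot>\<^bsub>F\<^esub> e m n | c m n.
            c \<in> carrier R \<and> m \<in> carrier M \<and> n \<in> carrier N}))"

definition tensor_module where
  "tensor_module R M N =
     quotient_module (free_module R (carrier M \<times> carrier N)) (tensor_kernel R M N)"

definition pure_tensor where
  "pure_tensor R M N m n =
     tensor_kernel R M N +>\<^bsub>free_module R (carrier M \<times> carrier N)\<^esub> free_basis R (m, n)"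


section \<open>Hom-Lie algebras\<close>

record ('k, 'a) hom_lie = "('k, 'a) module" +
  bracket :: "['a, 'a] \<Rightarrow> 'a" ("(\<lblot>_, _\<rblot>\<index>)")
  twist :: "'a \<Rightarrow> 'a"

text \<open>All Hom-Lie algebras are multiplicative.\<close>

locale hom_lie_algebra = module R L + field R for R and L (structure) +
  assumes bracket_bilinear: "bilinear_map R L L L (bracket L)"
    and twist_linear: "linear_map R L L (twist L)"
    and bracket_skew:
      "\<lbrakk>x \<in> carrier L; y \<in> carrier L\<rbrakk> \<Longrightarrow> \<lblot>x, y\<rblot> = \<ominus>\<^bsub>L\<^esub> \<lblot>y, x\<rblot>"
    and hom_jacobi:
      "\<lbrakk>x \<in> carrier L; y \<in> carrier L; z \<in> carrier L\<rbrakk> \<Longrightarrow>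
       \<lblot>twist L x, \<lblot>y, z\<rblot>\<rblot> \<oplus>\<^bsub>L\<^esub> \<lblot>twist L z, \<lblot>x, y\<rblot>\<rblot> \<oplus>\<^bsub>L\<^esub> \<lblot>twist L y, \<lblot>z, x\<rblot>\<rblot> = \<zero>\<^bsub>L\<^esub>"
    and twist_multiplicative:
      "\<lbrakk>x \<in> carrier L; y \<in> carrier L\<rbrakk> \<Longrightarrow> twist L \<lblot>x, y\<rblot> = \<lblot>twist L x, twist L y\<rblot>"

definition hom_lie_hom where
  "hom_lie_hom R L L' =
     {f. hom_lie_algebra R L \<and> hom_lie_algebra R L' \<and> linear_map R L L' f \<and>
         (\<forall>x\<in>carrier L. \<forall>y\<in>carrier L. f \<lblot>x, y\<rblot>\<^bsub>L\<^esub> = \<lblot>f x, f y\<rblot>\<^bsub>L'\<^esub>) \<and>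
         (\<forall>x\<in>carrier L. f (twist L x) = twist L' (f x))}"

definition hom_lie_iso where
  "hom_lie_iso R L L' = {f \<in> hom_lie_hom R L L'. bij_betw f (carrier L) (carrier L')}"

text \<open>
  A Hom-ideal is given as a structure of its own whose operations are the restrictions of those of
  the ambient Hom-Lie algebra. Thus one \<open>K\<close> can be a Hom-ideal of two Hom-Lie algebras at once.
\<close>

definition hom_ideal where
  "hom_ideal R K L \<longleftrightarrow>
     submodule (carrier K) R L \<and>
     (\<forall>h\<in>carrier K. twist L h \<in> carrier K) \<and>
     (\<forall>h\<in>carrier K. \<forall>x\<in>carrier L. \<lblot>h, x\<rblot>\<^bsub>L\<^esub> \<in> carrier K) \<and>
     \<zero>\<^bsub>K\<^esub> = \<zero>\<^bsub>L\<^esub> \<and>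
     (\<forall>x\<in>carrier K. \<forall>y\<in>carrier K. x \<oplus>\<^bsub>K\<^esub> y = x \<oplus>\<^bsub>L\<^esub> y) \<and>
     (\<forall>c\<in>carrier R. \<forall>x\<in>carrier K. c \<odot>\<^bsub>K\<^esub> x = c \<odot>\<^bsub>L\<^esub> x) \<and>
     (\<forall>x\<in>carrier K. \<forall>y\<in>carrier K. \<lblot>x, y\<rblot>\<^bsub>K\<^esub> = \<lblot>x, y\<rblot>\<^bsub>L\<^esub>) \<and>
     (\<forall>x\<in>carrier K. twist K x = twist L x)"

definition hom_lie_quotient ::
    "('k, 'a, 'z) hom_lie_scheme \<Rightarrow> 'a set \<Rightarrow> ('k, 'a set) hom_lie" where
  "hom_lie_quotient L I =
     module.extend (quotient_module L I)
       (hom_lie.fields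
          (\<lambda>X Y. \<Union>x\<in>X. \<Union>y\<in>Y. I +>\<^bsub>L\<^esub> \<lblot>x, y\<rblot>\<^bsub>L\<^esub>)
          (\<lambda>X. \<Union>x\<in>X. I +>\<^bsub>L\<^esub> twist L x))"


section \<open>Hom-actions\<close>

definition hom_action where
  "hom_action R L M act \<longleftrightarrow>
     bilinear_map R L M M act \<and>
     (\<forall>x\<in>carrier L. \<forall>y\<in>carrier L. \<forall>m\<in>carrier M.
        act \<lblot>x, y\<rblot>\<^bsub>L\<^esub> (twist M m) = act (twist L x) (act y m) \<ominus>\<^bsub>M\<^esub> act (twist L y) (act x m)) \<and>
     (\<forall>x\<in>carrier L. \<forall>m\<in>carrier M. \<forall>m'\<in>carrier M.
        act (twist L x) \<lblot>m, m'\<rblot>\<^bsub>M\<^esub> = \<lblot>act x m, twist M m'\<rblot>\<^bsub>M\<^esub> \<oplus>\<^bsub>M\<^esub> \<lblot>twist M m, act x m'\<rblot>\<^bsub>M\<^esub>) \<and>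
     (\<forall>x\<in>carrier L. \<forall>m\<in>carrier M. twist M (act x m) = act (twist L x) (twist M m))"

text \<open>Here \<open>M\<close> acts on \<open>N\<close> by \<open>a\<close>, and \<open>N\<close> acts on \<open>M\<close> by \<open>b\<close>.\<close>

definition compatible_hom_actions where
  "compatible_hom_actions R M N a b \<longleftrightarrow>
     hom_action R M N a \<and> hom_action R N M b \<and>
     (\<forall>m\<in>carrier M. \<forall>m'\<in>carrier M. \<forall>n\<in>carrier N. b (a m n) m' = \<lblot>m', b n m\<rblot>\<^bsub>M\<^esub>) \<and>
     (\<forall>m\<in>carrier M. \<forall>n\<in>carrier N. \<forall>n'\<in>carrier N. a (b n m) n' = \<lblot>n', a m n\<rblot>\<^bsub>N\<^esub>)"

text \<open>
  The map \<open>L/I \<times> M/J \<rightarrow> M/J\<close> induced by an action of \<open>L\<close> on \<open>M\<close>. By the remark on unions above, requiring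
  its values to lie in \<open>M/J\<close> amounts to requiring that it is well defined.
\<close>

definition quotient_action where
  "quotient_action M J act X Y = (\<Union>x\<in>X. \<Union>y\<in>Y. J +>\<^bsub>M\<^esub> act x y)"


section \<open>The non-abelian tensor product\<close>

definition star_relators where
  "star_relators R M N a b =
     (let T = tensor_module R M N;
          t = pure_tensor R M N
      in
        {t \<lblot>m, m'\<rblot>\<^bsub>M\<^esub> (twist N n) \<ominus>\<^bsub>T\<^esub> t (twist M m) (a m' n) \<oplus>\<^bsub>T\<^esub> t (twist M m') (a m n) | m m' n.
           m \<in> carrier M \<and> m' \<in> carrier M \<and> n \<in> carrier N} \<union>
        {t (twist M m) \<lblot>n, n'\<rblot>\<^bsub>N\<^esub> \<ominus>\<^bsub>T\<^esub> t (b n' m) (twist N n) \<oplus>\<^bsub>T\<^esub> t (b n m) (twist N n') | m n n'.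
           m \<in> carrier M \<and> n \<in> carrier N \<and> n' \<in> carrier N} \<union>
        {t (b n m) (a m n) | m n.
           m \<in> carrier M \<and> n \<in> carrier N} \<union>
        {t (b n m) (a m' n') \<oplus>\<^bsub>T\<^esub> t (b n' m') (a m n) | m m' n n'.
           m \<in> carrier M \<and> m' \<in> carrier M \<and> n \<in> carrier N \<and> n' \<in> carrier N} \<union>
        {t \<lblot>b n m, b n' m'\<rblot>\<^bsub>M\<^esub> (twist N (a m'' n''))
           \<oplus>\<^bsub>T\<^esub> t \<lblot>b n' m', b n'' m''\<rblot>\<^bsub>M\<^esub> (twist N (a m n))
           \<oplus>\<^bsub>T\<^esub> t \<lblot>b n'' m'', b n m\<rblot>\<^bsub>M\<^esub> (twist N (a m' n')) | m m' m'' n n' n''.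
           m \<in> carrier M \<and> m' \<in> carrier M \<and> m'' \<in> carrier M \<and>
           n \<in> carrier N \<and> n' \<in> carrier N \<and> n'' \<in> carrier N})"

definition star_kernel where
  "star_kernel R M N a b = subspace_span R (tensor_module R M N) (star_relators R M N a b)"

definition star_space where
  "star_space R M N a b = quotient_module (tensor_module R M N) (star_kernel R M N a b)"

definition star_elem where
  "star_elem R M N a b m n =
     star_kernel R M N a b +>\<^bsub>tensor_module R M N\<^esub> pure_tensor R M N m n"

text \<open>
  Bracket and endomorphism are the (bi)linear extensions of the prescribed values on the generators
  \<open>m \<star> n\<close>. These generators span, so there is at most one such extension on the carrier.
\<close>

definition is_star_bracket where
  "is_star_bracket R M N a b B \<longleftrightarrow>
     (let V = star_space R M N a b; s = star_elem R M N a b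
      in bilinear_map R V V V B \<and>
         (\<forall>m\<in>carrier M. \<forall>m'\<in>carrier M. \<forall>n\<in>carrier N. \<forall>n'\<in>carrier N.
            B (s m n) (s m' n') = \<ominus>\<^bsub>V\<^esub> s (b n m) (a m' n')))"

definition is_star_twist where
  "is_star_twist R M N a b A \<longleftrightarrow>
     (let V = star_space R M N a b; s = star_elem R M N a b
      in linear_map R V V A \<and>
         (\<forall>m\<in>carrier M. \<forall>n\<in>carrier N. A (s m n) = s (twist M m) (twist N n)))"

definition star where
  "star R M N a b =
     module.extend (star_space R M N a b)
       (hom_lie.fields
          (SOME B. is_star_bracket R M N a b B)
          (SOME A. is_star_twist R M N a b A))"

text \<open>
  In characteristic different from 2 the bracket of \<open>M \<star> N\<close> exists for all compatible Hom-actions.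
  In characteristic 2 skew-symmetry \<open>[x, y] = - [y, x]\<close> does not give \<open>[x, x] = 0\<close>, and then the
  prescription on generators may fail to respect the relators \<open>\<^sup>nm \<otimes> \<^sup>mn\<close>.
  The following says that it does define a bracket.
\<close>

definition star_defined where
  "star_defined R M N a b \<longleftrightarrow> (\<exists>B. is_star_bracket R M N a b B)"

definition star_inclusion where
  "star_inclusion R M N M' N' a b f \<longleftrightarrow>
     f \<in> hom_lie_hom R (star R M N a b) (star R M' N' a b) \<and>
     (\<forall>m\<in>carrier M. \<forall>n\<in>carrier N. f (star_elem R M N a b m n) = star_elem R M' N' a b m n)"

end

theory Submission
  imports Defs
begin

text \<open>
  The tensor product \<open>M \<star> N\<close> is universal for bilinear maps on \<open>M \<times> N\<close> that satisfy the relations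
  (i)--(v). Both directions of the isomorphism come from this universal property. The map
  \<open>g \<star> h \<mapsto> (g + K) \<star> (h + K)\<close> vanishes on \<open>K\<^sub>1 + K\<^sub>2\<close>, since \<open>k \<star> h\<close> and \<open>g \<star> k\<close> go to
  \<open>0\<close>; conversely \<open>(g + K, h + K) \<mapsto> g \<star> h + (K\<^sub>1 + K\<^sub>2)\<close> is well defined and satisfies the
  relations. The two induced linear maps are mutually inverse on generators.

  For the bracket, \<open>m \<star> n \<mapsto> \<^sup>nm\<close> and \<open>m \<star> n \<mapsto> \<^sup>mn\<close> respect all relations, where relation (iii)
  needs \<open>[x, x] = 0\<close> and hence characteristic different from 2. The bracket of \<open>G/K \<star> H/K\<close> is
  transported along the linear isomorphism, so that it exists in characteristic 2 as well.
\<close>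

section \<open>Linear and bilinear maps\<close>

text \<open>\<open>star\<close> selects its bracket and its twist by \<open>SOME\<close>, so nothing
  is known about either until some map with the prescribed values on generators has been exhibited.
  The isomorphism is therefore found first as a map of vector spaces, and its compatibility with
  bracket and twist is checked afterwards on generators. Relators (iv) and (v) are skew-symmetry and
  the Hom-Jacobi identity of the tensor product, evaluated on generators. Quotient operations are
  unions over representatives. For brackets and twists, independence of the representatives is
  proved; for the induced actions it is extracted from the assumption that they take values in the
  quotient, since a union of cosets that is itself a coset consists of a single one.\<close>

context abelian_group
begin

lemma minus_eq_zero_iff:
  "\<lbrakk>x \<in> carrier G; y \<in> carrier G\<rbrakk> \<Longrightarrow> x \<ominus> y = \<zero> \<longleftrightarrow> x = y"
  by (metis a_inv_closed minus_equality minus_minus minus_eq r_neg)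

text \<open>The shape of relator (i) under the action \<open>b\<close>, and of relator (ii) under
  \<open>a\<close>, once the derivation rule is expanded: the middle terms cancel and the outer pair
  vanishes by skew-symmetry.\<close>

lemma cancel_outer:
  "\<lbrakk>x \<in> carrier G; y \<in> carrier G; z \<in> carrier G; x \<oplus> z = \<zero>\<rbrakk> \<Longrightarrow> (x \<oplus> y) \<ominus> y \<oplus> z = \<zero>"
  by (simp add: a_minus_def a_assoc r_neg1 r_neg2)

text \<open>The shape of relator (i) under \<open>a\<close>, and of relator (ii) under
  \<open>b\<close>, once the action of a bracket is expanded.\<close>

lemma cancel_inner:
  "\<lbrakk>x \<in> carrier G; y \<in> carrier G\<rbrakk> \<Longrightarrow> (x \<ominus> y) \<ominus> x \<oplus> y = \<zero>"
  by (simp add: a_minus_def a_ac r_neg1 r_neg2 r_neg l_neg)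

end

text \<open>Operations are compared on the carrier only, because a Hom-ideal agrees with its ambient
  algebra only there. The lemma also carries the module structure over to the extended records
  \<open>star\<close> and \<open>hom_lie_quotient\<close>.\<close>

lemma module_cong:
  assumes "module R V" "carrier W = carrier V" "\<zero>\<^bsub>W\<^esub> = \<zero>\<^bsub>V\<^esub>"
    and "\<And>x y. \<lbrakk>x \<in> carrier V; y \<in> carrier V\<rbrakk> \<Longrightarrow> x \<oplus>\<^bsub>W\<^esub> y = x \<oplus>\<^bsub>V\<^esub> y"
    and "\<And>c x. \<lbrakk>c \<in> carrier R; x \<in> carrier V\<rbrakk> \<Longrightarrow> c \<odot>\<^bsub>W\<^esub> x = c \<odot>\<^bsub>V\<^esub> x"
  shows "module R W"
proof -
  interpret V: module R V by fact
  show ?thesis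
  proof (rule moduleI)
    show "abelian_group W"
    proof (rule abelian_groupI)
      fix x assume "x \<in> carrier W"
      then show "\<exists>y\<in>carrier W. y \<oplus>\<^bsub>W\<^esub> x = \<zero>\<^bsub>W\<^esub>"
        using V.add.l_inv_ex[of x] assms by auto
    qed (simp_all add: assms(2-4) V.a_ac)
  qed (simp_all add: assms(2-) V.R.is_cring V.smult_l_distr V.smult_r_distr V.smult_assoc1)
qed

lemma linear_mapI:
  assumes "\<And>x. x \<in> carrier V \<Longrightarrow> f x \<in> carrier W"
    and "\<And>x y. \<lbrakk>x \<in> carrier V; y \<in> carrier V\<rbrakk> \<Longrightarrow> f (x \<oplus>\<^bsub>V\<^esub> y) = f x \<oplus>\<^bsub>W\<^esub> f y"
    and "\<And>c x. \<lbrakk>c \<in> carrier R; x \<in> carrier V\<rbrakk> \<Longrightarrow> f (c \<odot>\<^bsub>V\<^esub> x) = c \<odot>\<^bsub>W\<^esub> f x"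
  shows "linear_map R V W f"
  using assms unfolding linear_map_def by blast

lemma linear_map_closed: "\<lbrakk>linear_map R V W f; x \<in> carrier V\<rbrakk> \<Longrightarrow> f x \<in> carrier W"
  and linear_map_add:
    "\<lbrakk>linear_map R V W f; x \<in> carrier V; y \<in> carrier V\<rbrakk> \<Longrightarrow> f (x \<oplus>\<^bsub>V\<^esub> y) = f x \<oplus>\<^bsub>W\<^esub> f y"
  and linear_map_smult:
    "\<lbrakk>linear_map R V W f; c \<in> carrier R; x \<in> carrier V\<rbrakk> \<Longrightarrow> f (c \<odot>\<^bsub>V\<^esub> x) = c \<odot>\<^bsub>W\<^esub> f x"
  unfolding linear_map_def by blast+

lemma linear_map_zero:
  assumes "linear_map R V W f" "module R V" "module R W"
  shows "f \<zero>\<^bsub>V\<^esub> = \<zero>\<^bsub>W\<^esub>"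
proof -
  interpret V: module R V by fact
  interpret W: module R W by fact
  have "f \<zero>\<^bsub>V\<^esub> \<oplus>\<^bsub>W\<^esub> f \<zero>\<^bsub>V\<^esub> = f \<zero>\<^bsub>V\<^esub>"
    using linear_map_add[OF assms(1), of "\<zero>\<^bsub>V\<^esub>" "\<zero>\<^bsub>V\<^esub>"] by simp
  then show ?thesis
    using linear_map_closed[OF assms(1), of "\<zero>\<^bsub>V\<^esub>"] by simp
qed

lemma linear_map_neg:
  assumes "linear_map R V W f" "module R V" "module R W" "x \<in> carrier V"
  shows "f (\<ominus>\<^bsub>V\<^esub> x) = \<ominus>\<^bsub>W\<^esub> f x"
proof -
  interpret V: module R V by fact
  interpret W: module R W by fact
  have "f (\<ominus>\<^bsub>V\<^esub> x) \<oplus>\<^bsub>W\<^esub> f x = \<zero>\<^bsub>W\<^esub>"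
    using linear_map_add[OF assms(1), of "\<ominus>\<^bsub>V\<^esub> x" x] linear_map_zero[OF assms(1-3)] assms(4)
    by (simp add: V.l_neg)
  then show ?thesis
    using linear_map_closed[OF assms(1)] assms(4) by (metis V.a_inv_closed W.minus_equality)
qed

lemma linear_map_minus:
  assumes "linear_map R V W f" "module R V" "module R W" "x \<in> carrier V" "y \<in> carrier V"
  shows "f (x \<ominus>\<^bsub>V\<^esub> y) = f x \<ominus>\<^bsub>W\<^esub> f y"
proof -
  interpret V: module R V by fact
  show ?thesis
    using linear_map_add[OF assms(1)] linear_map_neg[OF assms(1-3)] assms(4,5)
    by (simp add: a_minus_def)
qed

lemma linear_map_comp:
  assumes "linear_map R U V f" "linear_map R V W g"
  shows "linear_map R U W (\<lambda>x. g (f x))"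
  using assms unfolding linear_map_def by (simp add: Pi_iff)

lemma linear_map_id: "linear_map R V V (\<lambda>x. x)"
  by (auto intro: linear_mapI)

lemma linear_map_const_zero:
  assumes "module R W"
  shows "linear_map R V W (\<lambda>x. \<zero>\<^bsub>W\<^esub>)"
proof -
  interpret W: module R W by fact
  show ?thesis by (auto intro: linear_mapI)
qed

lemma linear_map_plus:
  assumes "module R W" "linear_map R V W f" "linear_map R V W g"
  shows "linear_map R V W (\<lambda>x. f x \<oplus>\<^bsub>W\<^esub> g x)"
proof -
  interpret W: module R W by fact
  show ?thesis
    using linear_map_closed[OF assms(2)] linear_map_closed[OF assms(3)]
    by (intro linear_mapI)
      (simp_all add: linear_map_add[OF assms(2)] linear_map_add[OF assms(3)]
        linear_map_smult[OF assms(2)] linear_map_smult[OF assms(3)] W.a_ac W.smult_r_distr)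
qed

lemma linear_map_uminus:
  assumes "module R W" "linear_map R V W f"
  shows "linear_map R V W (\<lambda>x. \<ominus>\<^bsub>W\<^esub> f x)"
proof -
  interpret W: module R W by fact
  show ?thesis
    using linear_map_closed[OF assms(2)]
    by (intro linear_mapI)
      (simp_all add: linear_map_add[OF assms(2)] linear_map_smult[OF assms(2)]
        W.minus_add W.smult_r_minus)
qed

lemma bilinear_mapI:
  assumes "\<And>x. x \<in> carrier U \<Longrightarrow> linear_map R V W (\<lambda>y. f x y)"
    and "\<And>y. y \<in> carrier V \<Longrightarrow> linear_map R U W (\<lambda>x. f x y)"
  shows "bilinear_map R U V W f"
  using assms unfolding bilinear_map_def by blast

lemma bilinear_map_right: "\<lbrakk>bilinear_map R U V W f; x \<in> carrier U\<rbrakk> \<Longrightarrow> linear_map R V W (\<lambda>y. f x y)"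
  and bilinear_map_left: "\<lbrakk>bilinear_map R U V W f; y \<in> carrier V\<rbrakk> \<Longrightarrow> linear_map R U W (\<lambda>x. f x y)"
  unfolding bilinear_map_def by blast+

lemma bilinear_map_swap: "bilinear_map R U V W f \<longleftrightarrow> bilinear_map R V U W (\<lambda>x y. f y x)"
  unfolding bilinear_map_def by blast

lemma bilinear_map_closed:
  "\<lbrakk>bilinear_map R U V W f; x \<in> carrier U; y \<in> carrier V\<rbrakk> \<Longrightarrow> f x y \<in> carrier W"
  by (rule linear_map_closed[OF bilinear_map_right])

lemma bilinear_map_comp:
  assumes "bilinear_map R U V W f" "linear_map R U' U g" "linear_map R V' V h" "linear_map R W W' k"
  shows "bilinear_map R U' V' W' (\<lambda>x y. k (f (g x) (h y)))"
  by (intro bilinear_mapI linear_map_comp[OF _ assms(4)] linear_map_comp[OF assms(3)]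
      linear_map_comp[OF assms(2), of _ "\<lambda>x. f x _"]
      bilinear_map_right[OF assms(1)] bilinear_map_left[OF assms(1)]
      linear_map_closed[OF assms(2)] linear_map_closed[OF assms(3)])

section \<open>Spans and quotients\<close>

text \<open>Closure under negation follows from closure under scalars, as negation is multiplication
  by minus one.\<close>

lemma submodule_iff:
  assumes "module R V"
  shows "submodule W R V \<longleftrightarrow> W \<subseteq> carrier V \<and> \<zero>\<^bsub>V\<^esub> \<in> W \<and> (\<forall>x\<in>W. \<forall>y\<in>W. x \<oplus>\<^bsub>V\<^esub> y \<in> W) \<and>
    (\<forall>c\<in>carrier R. \<forall>x\<in>W. c \<odot>\<^bsub>V\<^esub> x \<in> W)" (is "_ \<longleftrightarrow> ?P")
proof
  interpret module R V by fact
  show "submodule W R V" if W: ?P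
  proof (rule submoduleI)
    show "\<ominus>\<^bsub>V\<^esub> x \<in> W" if "x \<in> W" for x
    proof -
      have x: "x \<in> carrier V" using W that by blast
      have "\<ominus>\<^bsub>V\<^esub> x = (\<ominus>\<^bsub>R\<^esub> \<one>\<^bsub>R\<^esub>) \<odot>\<^bsub>V\<^esub> x" using smult_l_minus[of "\<one>\<^bsub>R\<^esub>" x] x by simp
      then show ?thesis using W that by simp
    qed
  qed (use W in auto)
  show ?P if "submodule W R V"
    using submoduleE[OF that] subgroup.one_closed[OF submodule.axioms(1)[OF that]] by auto
qed

text \<open>The main device for spreading a closure property from generators: the elements that a
  linear map sends into \<open>U\<close> form a submodule, so it suffices to find the generators
  among them.\<close>

lemma submodule_vimage:
  assumes "module R V" "module R W" "linear_map R V W f" "submodule U R W"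
  shows "submodule {x \<in> carrier V. f x \<in> U} R V"
proof -
  interpret V: module R V by fact
  show ?thesis
    using assms(4) linear_map_zero[OF assms(3,1,2)]
    unfolding submodule_iff[OF assms(1)] submodule_iff[OF assms(2)]
    by (auto simp: linear_map_add[OF assms(3)] linear_map_smult[OF assms(3)])
qed

lemma submodule_image:
  assumes "module R V" "module R W" "linear_map R V W f"
  shows "submodule (f ` carrier V) R W"
proof -
  interpret V: module R V by fact
  have "\<zero>\<^bsub>W\<^esub> \<in> f ` carrier V"
    using linear_map_zero[OF assms(3,1,2)] V.zero_closed by (metis imageI)
  then show ?thesis
    unfolding submodule_iff[OF assms(2)]
    by (auto simp: linear_map_closed[OF assms(3)]
        linear_map_add[OF assms(3), symmetric] linear_map_smult[OF assms(3), symmetric])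
qed

lemma submodule_zero:
  assumes "module R V"
  shows "submodule {\<zero>\<^bsub>V\<^esub>} R V"
proof -
  interpret V: module R V by fact
  show ?thesis unfolding submodule_iff[OF assms] by auto
qed

lemma (in module) submodule_set_add:
  assumes U: "submodule U R M" and W: "submodule W R M"
  shows "submodule (U <+>\<^bsub>M\<^esub> W) R M"
proof -
  have mem: "x \<in> U <+>\<^bsub>M\<^esub> W \<longleftrightarrow> (\<exists>u\<in>U. \<exists>w\<in>W. x = u \<oplus>\<^bsub>M\<^esub> w)" for x
    unfolding set_add_def' by blast
  note U' = U[unfolded submodule_iff[OF module_axioms]]
  note W' = W[unfolded submodule_iff[OF module_axioms]]
  show ?thesis
    unfolding submodule_iff[OF module_axioms]
  proof (intro conjI ballI subsetI)
    fix x assume "x \<in> U <+>\<^bsub>M\<^esub> W"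
    then obtain u w where x: "u \<in> U" "w \<in> W" "x = u \<oplus>\<^bsub>M\<^esub> w" unfolding mem by blast
    then have uw: "u \<in> carrier M" "w \<in> carrier M" using U' W' by auto
    then show "x \<in> carrier M" using x by simp
    show "c \<odot>\<^bsub>M\<^esub> x \<in> U <+>\<^bsub>M\<^esub> W" if "c \<in> carrier R" for c
      unfolding mem using U' W' uw x that by (metis smult_r_distr)
    fix y assume "y \<in> U <+>\<^bsub>M\<^esub> W"
    then obtain u' w' where y: "u' \<in> U" "w' \<in> W" "y = u' \<oplus>\<^bsub>M\<^esub> w'" unfolding mem by blast
    then have uw': "u' \<in> carrier M" "w' \<in> carrier M" using U' W' by auto
    have "x \<oplus>\<^bsub>M\<^esub> y = (u \<oplus>\<^bsub>M\<^esub> u') \<oplus>\<^bsub>M\<^esub> (w \<oplus>\<^bsub>M\<^esub> w')"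
      using x y uw uw' by (simp add: M.a_ac)
    then show "x \<oplus>\<^bsub>M\<^esub> y \<in> U <+>\<^bsub>M\<^esub> W" unfolding mem using U' W' x y by blast
  next
    show "\<zero>\<^bsub>M\<^esub> \<in> U <+>\<^bsub>M\<^esub> W"
      unfolding mem using U' W' by (metis M.r_zero M.zero_closed)
  qed
qed

text \<open>Linear maps that agree on generators agree everywhere, because this submodule then
  contains their span.\<close>

lemma submodule_equalizer:
  assumes "module R V" "module R W" "linear_map R V W f" "linear_map R V W g"
  shows "submodule {x \<in> carrier V. f x = g x} R V"
proof -
  interpret V: module R V by fact
  show ?thesis
    unfolding submodule_iff[OF assms(1)]
    by (auto simp: linear_map_add[OF assms(3)] linear_map_smult[OF assms(3)]
        linear_map_add[OF assms(4)] linear_map_smult[OF assms(4)]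
        linear_map_zero[OF assms(3,1,2)] linear_map_zero[OF assms(4,1,2)])
qed

lemma subspace_span_minimal:
  "\<lbrakk>submodule W R V; S \<subseteq> W\<rbrakk> \<Longrightarrow> subspace_span R V S \<subseteq> W"
  unfolding subspace_span_def by (rule hull_minimal)

lemma subspace_span_superset: "S \<subseteq> subspace_span R V S"
  unfolding subspace_span_def by (rule hull_subset)

text \<open>The hull is an intersection of submodules. It stays inside the carrier because the
  carrier itself is one of the submodules containing \<open>S\<close>.\<close>

lemma submodule_subspace_span:
  assumes "module R V" "S \<subseteq> carrier V"
  shows "submodule (subspace_span R V S) R V"
proof -
  interpret module R V by fact
  have "submodule (carrier V) R V" by (rule carrier_is_submodule)
  then show ?thesis
    unfolding submodule_iff[OF assms(1)] subspace_span_def hull_def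
    using assms(2) by auto
qed

text \<open>The criterion for factoring through a quotient by a span: the kernel is a submodule, so
  only the relators have to be tested.\<close>

lemma linear_map_vanishes_on_span:
  assumes "module R V" "module R W" "linear_map R V W f" "S \<subseteq> carrier V"
    and "\<And>x. x \<in> S \<Longrightarrow> f x = \<zero>\<^bsub>W\<^esub>" "x \<in> subspace_span R V S"
  shows "f x = \<zero>\<^bsub>W\<^esub>"
  using subspace_span_minimal[OF submodule_vimage[OF assms(1-3) submodule_zero[OF assms(2)]], of S]
    assms(4-6) by blast

lemma span_image:
  assumes "module R V" "module R W" "linear_map R V W f" "f ` carrier V = carrier W"
    and "carrier V \<subseteq> subspace_span R V S" "S \<subseteq> carrier V"
  shows "carrier W \<subseteq> subspace_span R W (f ` S)"
proof -
  have "f ` S \<subseteq> carrier W" using assms(4,6) by blast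
  then have "submodule {x \<in> carrier V. f x \<in> subspace_span R W (f ` S)} R V"
    by (intro submodule_vimage[OF assms(1-3)] submodule_subspace_span[OF assms(2)])
  moreover have "S \<subseteq> {x \<in> carrier V. f x \<in> subspace_span R W (f ` S)}"
    using assms(6) subspace_span_superset[of "f ` S" R W] by blast
  ultimately have "carrier V \<subseteq> {x \<in> carrier V. f x \<in> subspace_span R W (f ` S)}"
    by (rule order_trans[OF assms(5) subspace_span_minimal])
  then have "f ` carrier V \<subseteq> subspace_span R W (f ` S)" by fast
  then show ?thesis unfolding assms(4) .
qed

section \<open>Quotient modules and their universal property\<close>

lemma quotient_module_simps [simp]:
  "carrier (quotient_module V W) = a_rcosets\<^bsub>V\<^esub> W"
  "\<zero>\<^bsub>quotient_module V W\<^esub> = W"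
  "X \<oplus>\<^bsub>quotient_module V W\<^esub> Y = X <+>\<^bsub>V\<^esub> Y"
  "c \<odot>\<^bsub>quotient_module V W\<^esub> X = (\<Union>x\<in>X. W +>\<^bsub>V\<^esub> (c \<odot>\<^bsub>V\<^esub> x))"
  unfolding quotient_module_def by simp_all

locale module_quotient = module R V for R and V (structure) +
  fixes W
  assumes sub: "submodule W R V"
begin

sublocale abelian_subgroup W V
  using sub by (intro abelian_subgroupI3 additive_subgroupI submodule.axioms(1) abelian_group_axioms)

lemma W_smult: "\<lbrakk>c \<in> carrier R; x \<in> W\<rbrakk> \<Longrightarrow> c \<odot> x \<in> W"
  by (rule submodule.smult_closed[OF sub])

lemma coset_eq_iff:
  assumes "x \<in> carrier V" "y \<in> carrier V"
  shows "W +> x = W +> y \<longleftrightarrow> x \<ominus> y \<in> W"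
proof -
  have "W +> x = W +> y \<longleftrightarrow> x \<in> W +> y"
    using a_repr_independence' a_rcos_self assms by metis
  then show ?thesis using a_rcos_module assms by (simp add: a_minus_def)
qed

lemma coset_eq_zero_iff: "x \<in> carrier V \<Longrightarrow> W +> x = W \<longleftrightarrow> x \<in> W"
  using a_rcos_self a_rcos_const by metis

lemma coset_closed: "x \<in> carrier V \<Longrightarrow> W +> x \<in> a_rcosets W"
  by (rule a_rcosetsI[OF a_subset])

lemma coset_cases:
  assumes "X \<in> a_rcosets W"
  obtains x where "x \<in> carrier V" "X = W +> x"
  using assms unfolding A_RCOSETS_def' by auto

lemma mem_coset: "\<lbrakk>x \<in> carrier V; y \<in> W +> x\<rbrakk> \<Longrightarrow> y \<in> carrier V \<and> W +> y = W +> x"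
  using a_repr_independence' a_elemrcos_carrier by metis

text \<open>Evaluates the unions in the quotient operations: if every representative contributes the
  same set, the union collapses to that set.\<close>

lemma Union_coset:
  assumes "x \<in> carrier V" "\<And>y. \<lbrakk>y \<in> carrier V; W +> y = W +> x\<rbrakk> \<Longrightarrow> F y = F x"
  shows "(\<Union>y\<in>W +> x. F y) = F x"
  using mem_coset[OF assms(1)] a_rcos_self[OF assms(1)] assms(2) by blast

text \<open>Here independence of representatives is a conclusion. The element \<open>f x y\<close>
  lies in its own coset, hence in the union; as the union is a single coset, it must be the coset of
  \<open>f x y\<close>. The induced actions are evaluated this way.\<close>

lemma Union_cosets_closed:
  assumes "x \<in> X" "y \<in> Y" "f x y \<in> carrier V" "(\<Union>x\<in>X. \<Union>y\<in>Y. W +> f x y) \<in> a_rcosets W"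
  shows "(\<Union>x\<in>X. \<Union>y\<in>Y. W +> f x y) = W +> f x y"
proof -
  obtain u where u: "u \<in> carrier V" "(\<Union>x\<in>X. \<Union>y\<in>Y. W +> f x y) = W +> u"
    using assms(4) by (rule coset_cases)
  have "f x y \<in> W +> u"
    using a_rcos_self[OF assms(3)] assms(1,2) u(2) by blast
  then show ?thesis using u mem_coset by metis
qed

lemma coset_smult:
  assumes "c \<in> carrier R" "x \<in> carrier V"
  shows "c \<odot>\<^bsub>quotient_module V W\<^esub> (W +> x) = W +> (c \<odot> x)"
  unfolding quotient_module_simps
proof (rule Union_coset[OF assms(2)])
  fix y assume y: "y \<in> carrier V" "W +> y = W +> x"
  then have "c \<odot> (y \<ominus> x) \<in> W" using W_smult assms coset_eq_iff by blast
  then show "W +> (c \<odot> y) = W +> (c \<odot> x)"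
    using y assms by (simp add: coset_eq_iff a_minus_def smult_r_distr smult_r_minus)
qed

lemma quotient_is_module: "module R (quotient_module V W)"
proof (rule moduleI)
  show "abelian_group (quotient_module V W)"
  proof (rule abelian_groupI)
    fix X assume "X \<in> carrier (quotient_module V W)"
    then obtain x where x: "x \<in> carrier V" "X = W +> x" by (auto elim: coset_cases)
    then have "W +> (\<ominus> x) \<in> carrier (quotient_module V W)"
      and "(W +> (\<ominus> x)) \<oplus>\<^bsub>quotient_module V W\<^esub> X = \<zero>\<^bsub>quotient_module V W\<^esub>"
      by (simp_all add: coset_closed a_rcos_sum l_neg a_subset)
    then show "\<exists>Y\<in>carrier (quotient_module V W).
        Y \<oplus>\<^bsub>quotient_module V W\<^esub> X = \<zero>\<^bsub>quotient_module V W\<^esub>" by blast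
  qed (auto elim!: coset_cases simp: coset_closed a_rcos_sum a_ac a_subgroup_in_rcosets
      rcosets_add_eq)
next
  fix c X assume "c \<in> carrier R" "X \<in> carrier (quotient_module V W)"
  then show "c \<odot>\<^bsub>quotient_module V W\<^esub> X \<in> carrier (quotient_module V W)"
    by (auto elim!: coset_cases simp: coset_closed coset_smult simp del: quotient_module_simps(4))
next
  fix c d X assume "c \<in> carrier R" "d \<in> carrier R" "X \<in> carrier (quotient_module V W)"
  then show "(c \<oplus>\<^bsub>R\<^esub> d) \<odot>\<^bsub>quotient_module V W\<^esub> X =
      c \<odot>\<^bsub>quotient_module V W\<^esub> X \<oplus>\<^bsub>quotient_module V W\<^esub> d \<odot>\<^bsub>quotient_module V W\<^esub> X"
    by (auto elim!: coset_cases simp: coset_smult a_rcos_sum smult_l_distr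
        simp del: quotient_module_simps(4))
next
  fix c X Y assume "c \<in> carrier R" "X \<in> carrier (quotient_module V W)" "Y \<in> carrier (quotient_module V W)"
  then show "c \<odot>\<^bsub>quotient_module V W\<^esub> (X \<oplus>\<^bsub>quotient_module V W\<^esub> Y) =
      c \<odot>\<^bsub>quotient_module V W\<^esub> X \<oplus>\<^bsub>quotient_module V W\<^esub> c \<odot>\<^bsub>quotient_module V W\<^esub> Y"
    by (auto elim!: coset_cases simp: coset_smult a_rcos_sum smult_r_distr
        simp del: quotient_module_simps(4))
next
  fix c d X assume "c \<in> carrier R" "d \<in> carrier R" "X \<in> carrier (quotient_module V W)"
  then show "(c \<otimes>\<^bsub>R\<^esub> d) \<odot>\<^bsub>quotient_module V W\<^esub> X =
      c \<odot>\<^bsub>quotient_module V W\<^esub> (d \<odot>\<^bsub>quotient_module V W\<^esub> X)"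
    by (auto elim!: coset_cases simp: coset_smult smult_assoc1 simp del: quotient_module_simps(4))
next
  fix X assume "X \<in> carrier (quotient_module V W)"
  then show "\<one>\<^bsub>R\<^esub> \<odot>\<^bsub>quotient_module V W\<^esub> X = X"
    by (auto elim!: coset_cases simp: coset_smult simp del: quotient_module_simps(4))
qed (rule R.is_cring)

lemma linear_coset: "linear_map R V (quotient_module V W) (\<lambda>x. W +> x)"
  by (intro linear_mapI)
    (simp_all add: coset_closed coset_smult a_rcos_sum del: quotient_module_simps(4))

lemma coset_image: "(\<lambda>x. W +> x) ` carrier V = carrier (quotient_module V W)"
  by (auto elim: coset_cases intro: coset_closed)

lemma quotient_lift:
  assumes "module R U" "linear_map R V U f" "\<And>x. x \<in> W \<Longrightarrow> f x = \<zero>\<^bsub>U\<^esub>"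
  obtains g where "linear_map R (quotient_module V W) U g" "\<And>x. x \<in> carrier V \<Longrightarrow> g (W +> x) = f x"
proof
  \<comment> \<open>The value is read off at a chosen representative. Two representatives differ by
    an element of \<open>W\<close>, where \<open>f\<close> vanishes, so the choice is
    immaterial.\<close>
  define g where "g X = f (SOME x. x \<in> carrier V \<and> X = W +> x)" for X
  interpret U: module R U by fact
  have V: "module R V" by (rule module_axioms)
  show g: "g (W +> x) = f x" if x: "x \<in> carrier V" for x
  proof -
    define y where "y = (SOME y. y \<in> carrier V \<and> W +> x = W +> y)"
    have y: "y \<in> carrier V \<and> W +> x = W +> y" unfolding y_def by (rule someI) (use x in auto)
    then have "f (x \<ominus> y) = \<zero>\<^bsub>U\<^esub>" using coset_eq_iff x assms(3) by blast
    then have "f x \<ominus>\<^bsub>U\<^esub> f y = \<zero>\<^bsub>U\<^esub>" using linear_map_minus[OF assms(2) V assms(1)] x y by simp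
    then have "f x = f y"
      using x y linear_map_closed[OF assms(2)] by (simp add: U.minus_eq_zero_iff)
    then show ?thesis unfolding g_def y_def by simp
  qed
  show "linear_map R (quotient_module V W) U g"
    by (rule linear_mapI)
      (auto elim!: coset_cases simp: g coset_smult a_rcos_sum linear_map_closed[OF assms(2)]
        linear_map_add[OF assms(2)] linear_map_smult[OF assms(2)] simp del: quotient_module_simps(4))
qed

end

section \<open>Free modules and tensor products\<close>

lemma free_module_simps [simp]:
  "f \<in> carrier (free_module R X) \<longleftrightarrow>
     (\<forall>x. f x \<in> carrier R) \<and> finite {x. f x \<noteq> \<zero>\<^bsub>R\<^esub>} \<and> {x. f x \<noteq> \<zero>\<^bsub>R\<^esub>} \<subseteq> X"
  "\<zero>\<^bsub>free_module R X\<^esub> = (\<lambda>_. \<zero>\<^bsub>R\<^esub>)"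
  "f \<oplus>\<^bsub>free_module R X\<^esub> g = (\<lambda>x. f x \<oplus>\<^bsub>R\<^esub> g x)"
  "c \<odot>\<^bsub>free_module R X\<^esub> f = (\<lambda>x. c \<otimes>\<^bsub>R\<^esub> f x)"
  unfolding free_module_def by auto

context cring
begin

lemma free_module_add_closed:
  assumes "f \<in> carrier (free_module R X)" "g \<in> carrier (free_module R X)"
  shows "f \<oplus>\<^bsub>free_module R X\<^esub> g \<in> carrier (free_module R X)"
proof -
  have "{x. f x \<oplus> g x \<noteq> \<zero>} \<subseteq> {x. f x \<noteq> \<zero>} \<union> {x. g x \<noteq> \<zero>}" by auto
  then show ?thesis using assms by (auto intro: finite_subset)
qed

lemma free_module_smult_closed:
  assumes "c \<in> carrier R" "f \<in> carrier (free_module R X)"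
  shows "c \<odot>\<^bsub>free_module R X\<^esub> f \<in> carrier (free_module R X)"
proof -
  have "{x. c \<otimes> f x \<noteq> \<zero>} \<subseteq> {x. f x \<noteq> \<zero>}" using assms by auto
  then show ?thesis using assms by (auto intro: finite_subset)
qed

lemma free_module_is_module: "module R (free_module R X)"
proof (rule moduleI)
  show "abelian_group (free_module R X)"
  proof (rule abelian_groupI)
    fix f assume f: "f \<in> carrier (free_module R X)"
    then have "(\<lambda>x. \<ominus> f x) \<in> carrier (free_module R X)"
      by (simp add: a_inv_def[symmetric])
    moreover have "(\<lambda>x. \<ominus> f x) \<oplus>\<^bsub>free_module R X\<^esub> f = \<zero>\<^bsub>free_module R X\<^esub>"
      using f by (simp add: l_neg)
    ultimately show "\<exists>g\<in>carrier (free_module R X). g \<oplus>\<^bsub>free_module R X\<^esub> f = \<zero>\<^bsub>free_module R X\<^esub>"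
      by blast
  qed (use free_module_add_closed in \<open>auto simp: a_ac fun_eq_iff\<close>)
next
  fix c f assume "c \<in> carrier R" "f \<in> carrier (free_module R X)"
  then show "c \<odot>\<^bsub>free_module R X\<^esub> f \<in> carrier (free_module R X)"
    by (rule free_module_smult_closed)
qed (auto simp: is_cring l_distr r_distr m_assoc)

lemma free_basis_closed: "x \<in> X \<Longrightarrow> free_basis R x \<in> carrier (free_module R X)"
  by (auto simp: free_basis_def intro: finite_subset[of _ "{x}"])

text \<open>The induction runs over a finite set containing the support, not over the support
  itself, so that the coordinate being removed may already be zero.\<close>

lemma free_module_generated:
  "carrier (free_module R X) \<subseteq> subspace_span R (free_module R X) (free_basis R ` X)"
proof
  let ?F = "free_module R X"
  let ?W = "subspace_span R ?F (free_basis R ` X)"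
  have W: "submodule ?W R ?F"
    by (intro submodule_subspace_span free_module_is_module image_subsetI free_basis_closed)
  note W' = W[unfolded submodule_iff[OF free_module_is_module]]
  have *: "f \<in> ?W" if "finite A" "f \<in> carrier ?F" "{x. f x \<noteq> \<zero>} \<subseteq> A" "A \<subseteq> X" for A f
    using that
  proof (induction A arbitrary: f)
    case empty
    then have "f = \<zero>\<^bsub>?F\<^esub>" by auto
    then show ?case using W' by blast
  next
    case (insert y A)
    define g where "g = f(y := \<zero>)"
    have "{x. g x \<noteq> \<zero>} \<subseteq> A" using insert.prems by (auto simp: g_def)
    then have "g \<in> ?W" using insert
      by (intro insert.IH) (auto simp: g_def intro: finite_subset)
    moreover have "f y \<odot>\<^bsub>?F\<^esub> free_basis R y \<in> ?W"
      using W' insert.prems subspace_span_superset[of "free_basis R ` X" R ?F] by auto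
    moreover have "f = f y \<odot>\<^bsub>?F\<^esub> free_basis R y \<oplus>\<^bsub>?F\<^esub> g"
      using insert.prems by (auto simp: g_def free_basis_def fun_eq_iff)
    ultimately show ?case using W' by metis
  qed
  fix f assume "f \<in> carrier ?F"
  then show "f \<in> ?W" by (intro *[of "{x. f x \<noteq> \<zero>}"]) auto
qed

lemma free_module_lift:
  assumes "module R U" "f \<in> X \<rightarrow> carrier U"
  obtains g where "linear_map R (free_module R X) U g" "\<And>x. x \<in> X \<Longrightarrow> g (free_basis R x) = f x"
proof
  interpret U: module R U by fact
  define g where "g p = (\<Oplus>\<^bsub>U\<^esub>x\<in>{x. p x \<noteq> \<zero>}. p x \<odot>\<^bsub>U\<^esub> f x)" for p
  have f: "f x \<in> carrier U" if "x \<in> X" for x using assms(2) that by blast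
  \<comment> \<open>The sum over the support is replaced by one over any larger finite set, because
    \<open>p\<close>, \<open>q\<close> and their sum have different supports and must be compared
    over a common index set.\<close>
  have g: "g p = (\<Oplus>\<^bsub>U\<^esub>x\<in>A. p x \<odot>\<^bsub>U\<^esub> f x)"
    if "finite A" "{x. p x \<noteq> \<zero>} \<subseteq> A" "A \<subseteq> X" "\<And>x. p x \<in> carrier R" for p A
    unfolding g_def
    by (rule U.add.finprod_mono_neutral_cong_left) (use that f in auto)
  show "linear_map R (free_module R X) U g"
  proof (rule linear_mapI)
    fix p assume p: "p \<in> carrier (free_module R X)"
    then show "g p \<in> carrier U"
      using f unfolding g_def by (intro U.finsum_closed) auto
    fix q assume q: "q \<in> carrier (free_module R X)"
    let ?A = "{x. p x \<noteq> \<zero>} \<union> {x. q x \<noteq> \<zero>}"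
    have "g (p \<oplus>\<^bsub>free_module R X\<^esub> q) = (\<Oplus>\<^bsub>U\<^esub>x\<in>?A. (p x \<oplus> q x) \<odot>\<^bsub>U\<^esub> f x)"
      using p q by (subst g[of ?A]) auto
    also have "\<dots> = (\<Oplus>\<^bsub>U\<^esub>x\<in>?A. p x \<odot>\<^bsub>U\<^esub> f x \<oplus>\<^bsub>U\<^esub> q x \<odot>\<^bsub>U\<^esub> f x)"
      using p q f by (intro U.finsum_cong') (auto simp: U.smult_l_distr subset_iff)
    also have "\<dots> = (\<Oplus>\<^bsub>U\<^esub>x\<in>?A. p x \<odot>\<^bsub>U\<^esub> f x) \<oplus>\<^bsub>U\<^esub> (\<Oplus>\<^bsub>U\<^esub>x\<in>?A. q x \<odot>\<^bsub>U\<^esub> f x)"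
      using p q f by (intro U.finsum_addf) (auto simp: subset_iff)
    also have "\<dots> = g p \<oplus>\<^bsub>U\<^esub> g q"
      using p q by (simp add: g[of ?A p] g[of ?A q])
    finally show "g (p \<oplus>\<^bsub>free_module R X\<^esub> q) = g p \<oplus>\<^bsub>U\<^esub> g q" .
  next
    fix c p assume c: "c \<in> carrier R" and p: "p \<in> carrier (free_module R X)"
    let ?A = "{x. p x \<noteq> \<zero>}"
    have "g (c \<odot>\<^bsub>free_module R X\<^esub> p) = (\<Oplus>\<^bsub>U\<^esub>x\<in>?A. (c \<otimes> p x) \<odot>\<^bsub>U\<^esub> f x)"
      using p c by (subst g[of ?A]) auto
    also have "\<dots> = (\<Oplus>\<^bsub>U\<^esub>x\<in>?A. c \<odot>\<^bsub>U\<^esub> (p x \<odot>\<^bsub>U\<^esub> f x))"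
      using p c f by (intro U.finsum_cong') (auto simp: U.smult_assoc1 subset_iff)
    also have "\<dots> = c \<odot>\<^bsub>U\<^esub> g p"
      using p c f unfolding g_def by (intro U.finsum_smult_ldistr[symmetric]) (auto simp: subset_iff)
    finally show "g (c \<odot>\<^bsub>free_module R X\<^esub> p) = c \<odot>\<^bsub>U\<^esub> g p" .
  qed
  show "g (free_basis R x) = f x" if "x \<in> X" for x
    using that f by (subst g[of "{x}"]) (auto simp: free_basis_def)
qed

end

text \<open>The generating set that \<open>tensor_kernel\<close> contains inline, named so that a
  map can be tested on it alone.\<close>

definition tensor_relators where
  "tensor_relators R M N =
     (let F = free_module R (carrier M \<times> carrier N);
          e = (\<lambda>m n. free_basis R (m, n))
      in ({e (m \<oplus>\<^bsub>M\<^esub> m') n \<ominus>\<^bsub>F\<^esub> (e m n \<oplus>\<^bsub>F\<^esub> e m' n) | m m' n.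
            m \<in> carrier M \<and> m' \<in> carrier M \<and> n \<in> carrier N} \<union>
         {e m (n \<oplus>\<^bsub>N\<^esub> n') \<ominus>\<^bsub>F\<^esub> (e m n \<oplus>\<^bsub>F\<^esub> e m n') | m n n'.
            m \<in> carrier M \<and> n \<in> carrier N \<and> n' \<in> carrier N} \<union>
         {e (c \<odot>\<^bsub>M\<^esub> m) n \<ominus>\<^bsub>F\<^esub> c \<odot>\<^bsub>F\<^esub> e m n | c m n.
            c \<in> carrier R \<and> m \<in> carrier M \<and> n \<in> carrier N} \<union>
         {e m (c \<odot>\<^bsub>N\<^esub> n) \<ominus>\<^bsub>F\<^esub> c \<odot>\<^bsub>F\<^esub> e m n | c m n.
            c \<in> carrier R \<and> m \<in> carrier M \<and> n \<in> carrier N}))"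

lemma tensor_kernel_eq:
  "tensor_kernel R M N =
    subspace_span R (free_module R (carrier M \<times> carrier N)) (tensor_relators R M N)"
  unfolding tensor_kernel_def tensor_relators_def Let_def ..

lemma tensor_relatorsI:
  fixes R M N
  defines "F \<equiv> free_module R (carrier M \<times> carrier N)"
  assumes "m \<in> carrier M" "n \<in> carrier N"
  shows "m' \<in> carrier M \<Longrightarrow> free_basis R (m \<oplus>\<^bsub>M\<^esub> m', n) \<ominus>\<^bsub>F\<^esub>
      (free_basis R (m, n) \<oplus>\<^bsub>F\<^esub> free_basis R (m', n)) \<in> tensor_relators R M N"
    and "n' \<in> carrier N \<Longrightarrow> free_basis R (m, n \<oplus>\<^bsub>N\<^esub> n') \<ominus>\<^bsub>F\<^esub>
      (free_basis R (m, n) \<oplus>\<^bsub>F\<^esub> free_basis R (m, n')) \<in> tensor_relators R M N"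
    and "c \<in> carrier R \<Longrightarrow> free_basis R (c \<odot>\<^bsub>M\<^esub> m, n) \<ominus>\<^bsub>F\<^esub> c \<odot>\<^bsub>F\<^esub> free_basis R (m, n)
      \<in> tensor_relators R M N"
    and "c \<in> carrier R \<Longrightarrow> free_basis R (m, c \<odot>\<^bsub>N\<^esub> n) \<ominus>\<^bsub>F\<^esub> c \<odot>\<^bsub>F\<^esub> free_basis R (m, n)
      \<in> tensor_relators R M N"
  unfolding tensor_relators_def Let_def F_def using assms(2,3) by blast+

locale module_pair = M: module R M + N: module R N for R M N
begin

abbreviation "F \<equiv> free_module R (carrier M \<times> carrier N)"
abbreviation "e m n \<equiv> free_basis R (m, n)"
abbreviation "T \<equiv> tensor_module R M N"
abbreviation "t \<equiv> pure_tensor R M N"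

interpretation F: module R F
  by (rule M.free_module_is_module)

lemma basis_closed: "\<lbrakk>m \<in> carrier M; n \<in> carrier N\<rbrakk> \<Longrightarrow> e m n \<in> carrier F"
  by (rule M.free_basis_closed) simp

lemma tensor_relators_closed: "tensor_relators R M N \<subseteq> carrier F"
  unfolding tensor_relators_def Let_def
  by (auto simp: basis_closed simp del: free_module_simps)

lemma tensor_quotient: "module_quotient R F (tensor_kernel R M N)"
  unfolding module_quotient_def module_quotient_axioms_def tensor_kernel_eq
  using F.module_axioms tensor_relators_closed by (blast intro: submodule_subspace_span)

interpretation FT: module_quotient R F "tensor_kernel R M N"
  by (rule tensor_quotient)

lemma tensor_is_module: "module R T"
  unfolding tensor_module_def by (rule FT.quotient_is_module)

text \<open>Each of the four families of relators is one law of bilinearity: elements of the free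
  module whose difference is a relator have the same coset.\<close>

lemma pure_tensor_bilinear: "bilinear_map R M N T t"
proof -
  have eq: "tensor_kernel R M N +>\<^bsub>F\<^esub> x = tensor_kernel R M N +>\<^bsub>F\<^esub> y"
    if "x \<ominus>\<^bsub>F\<^esub> y \<in> tensor_relators R M N" "x \<in> carrier F" "y \<in> carrier F" for x y
    using FT.coset_eq_iff[OF that(2,3)] subsetD[OF subspace_span_superset that(1)]
    unfolding tensor_kernel_eq by blast
  note hom = linear_map_add[OF FT.linear_coset, symmetric] linear_map_smult[OF FT.linear_coset, symmetric]
  show ?thesis
    unfolding tensor_module_def
    by (intro bilinear_mapI linear_mapI; unfold pure_tensor_def)
      (simp_all add: basis_closed hom eq tensor_relatorsI linear_map_closed[OF FT.linear_coset]
        del: free_module_simps quotient_module_simps)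
qed

lemma tensor_generated:
  "carrier T \<subseteq> subspace_span R T {t m n | m n. m \<in> carrier M \<and> n \<in> carrier N}"
proof -
  let ?B = "free_basis R ` (carrier M \<times> carrier N)"
  have "carrier T \<subseteq> subspace_span R T ((\<lambda>x. tensor_kernel R M N +>\<^bsub>F\<^esub> x) ` ?B)"
    unfolding tensor_module_def
    by (rule span_image[OF F.module_axioms FT.quotient_is_module FT.linear_coset FT.coset_image
          M.free_module_generated]) (auto intro!: basis_closed simp del: free_module_simps)
  moreover have "(\<lambda>x. tensor_kernel R M N +>\<^bsub>F\<^esub> x) ` ?B =
      {t m n | m n. m \<in> carrier M \<and> n \<in> carrier N}"
    unfolding pure_tensor_def by auto
  ultimately show ?thesis by simp
qed

text \<open>\<open>f\<close> is first extended from the basis to the free module as a mere function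
  of pairs; its bilinearity then says that this extension kills the four families of
  relators.\<close>

lemma tensor_lift:
  assumes "module R U" "bilinear_map R M N U f"
  obtains g where "linear_map R T U g"
    "\<And>m n. \<lbrakk>m \<in> carrier M; n \<in> carrier N\<rbrakk> \<Longrightarrow> g (t m n) = f m n"
proof -
  interpret U: module R U by fact
  have "(\<lambda>(m, n). f m n) \<in> carrier M \<times> carrier N \<rightarrow> carrier U"
    using bilinear_map_closed[OF assms(2)] by auto
  then obtain h where h: "linear_map R F U h"
    and h_basis: "\<And>p. p \<in> carrier M \<times> carrier N \<Longrightarrow> h (free_basis R p) = (\<lambda>(m, n). f m n) p"
    using M.free_module_lift[OF assms(1)] by metis
  have he: "h (e m n) = f m n" if "m \<in> carrier M" "n \<in> carrier N" for m n
    using h_basis that by auto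
  note fc = bilinear_map_closed[OF assms(2)]
  have "h x = \<zero>\<^bsub>U\<^esub>" if "x \<in> tensor_relators R M N" for x
    using that unfolding tensor_relators_def Let_def
    by (auto simp: linear_map_minus[OF h F.module_axioms assms(1)] linear_map_add[OF h]
        linear_map_smult[OF h] he basis_closed F.a_closed F.smult_closed U.minus_eq_zero_iff fc
        linear_map_add[OF bilinear_map_left[OF assms(2)]]
        linear_map_add[OF bilinear_map_right[OF assms(2)]]
        linear_map_smult[OF bilinear_map_left[OF assms(2)]]
        linear_map_smult[OF bilinear_map_right[OF assms(2)]]
        simp del: free_module_simps)
  then have "h x = \<zero>\<^bsub>U\<^esub>" if "x \<in> tensor_kernel R M N" for x
    using linear_map_vanishes_on_span[OF F.module_axioms assms(1) h tensor_relators_closed] that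
    unfolding tensor_kernel_eq by blast
  then obtain g where "linear_map R (quotient_module F (tensor_kernel R M N)) U g"
    "\<And>x. x \<in> carrier F \<Longrightarrow> g (tensor_kernel R M N +>\<^bsub>F\<^esub> x) = h x"
    using FT.quotient_lift[OF assms(1) h] by metis
  then show ?thesis
    using that he basis_closed unfolding tensor_module_def pure_tensor_def by metis
qed

end

section \<open>The non-abelian tensor product\<close>

text \<open>Bilinear maps for which relators (i)-(v), with the pure tensor replaced by
  \<open>f\<close>, become zero. They correspond to the linear maps out of the star product.\<close>

definition hom_pairing where
  "hom_pairing R M N a b W f \<longleftrightarrow>
     bilinear_map R M N W f \<and>
     (\<forall>m\<in>carrier M. \<forall>m'\<in>carrier M. \<forall>n\<in>carrier N.
        f \<lblot>m, m'\<rblot>\<^bsub>M\<^esub> (twist N n) \<ominus>\<^bsub>W\<^esub> f (twist M m) (a m' n) \<oplus>\<^bsub>W\<^esub> f (twist M m') (a m n) = \<zero>\<^bsub>W\<^esub>) \<and>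
     (\<forall>m\<in>carrier M. \<forall>n\<in>carrier N. \<forall>n'\<in>carrier N.
        f (twist M m) \<lblot>n, n'\<rblot>\<^bsub>N\<^esub> \<ominus>\<^bsub>W\<^esub> f (b n' m) (twist N n) \<oplus>\<^bsub>W\<^esub> f (b n m) (twist N n') = \<zero>\<^bsub>W\<^esub>) \<and>
     (\<forall>m\<in>carrier M. \<forall>n\<in>carrier N. f (b n m) (a m n) = \<zero>\<^bsub>W\<^esub>) \<and>
     (\<forall>m\<in>carrier M. \<forall>m'\<in>carrier M. \<forall>n\<in>carrier N. \<forall>n'\<in>carrier N.
        f (b n m) (a m' n') \<oplus>\<^bsub>W\<^esub> f (b n' m') (a m n) = \<zero>\<^bsub>W\<^esub>) \<and>
     (\<forall>m\<in>carrier M. \<forall>m'\<in>carrier M. \<forall>m''\<in>carrier M. \<forall>n\<in>carrier N. \<forall>n'\<in>carrier N. \<forall>n''\<in>carrier N.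
        f \<lblot>b n m, b n' m'\<rblot>\<^bsub>M\<^esub> (twist N (a m'' n''))
          \<oplus>\<^bsub>W\<^esub> f \<lblot>b n' m', b n'' m''\<rblot>\<^bsub>M\<^esub> (twist N (a m n))
          \<oplus>\<^bsub>W\<^esub> f \<lblot>b n'' m'', b n m\<rblot>\<^bsub>M\<^esub> (twist N (a m' n')) = \<zero>\<^bsub>W\<^esub>)"

lemma hom_pairingI:
  assumes "bilinear_map R M N W f"
    and "\<And>m m' n. \<lbrakk>m \<in> carrier M; m' \<in> carrier M; n \<in> carrier N\<rbrakk> \<Longrightarrow>
        f \<lblot>m, m'\<rblot>\<^bsub>M\<^esub> (twist N n) \<ominus>\<^bsub>W\<^esub> f (twist M m) (a m' n) \<oplus>\<^bsub>W\<^esub> f (twist M m') (a m n) = \<zero>\<^bsub>W\<^esub>"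
    and "\<And>m n n'. \<lbrakk>m \<in> carrier M; n \<in> carrier N; n' \<in> carrier N\<rbrakk> \<Longrightarrow>
        f (twist M m) \<lblot>n, n'\<rblot>\<^bsub>N\<^esub> \<ominus>\<^bsub>W\<^esub> f (b n' m) (twist N n) \<oplus>\<^bsub>W\<^esub> f (b n m) (twist N n') = \<zero>\<^bsub>W\<^esub>"
    and "\<And>m n. \<lbrakk>m \<in> carrier M; n \<in> carrier N\<rbrakk> \<Longrightarrow> f (b n m) (a m n) = \<zero>\<^bsub>W\<^esub>"
    and "\<And>m m' n n'. \<lbrakk>m \<in> carrier M; m' \<in> carrier M; n \<in> carrier N; n' \<in> carrier N\<rbrakk> \<Longrightarrow>
        f (b n m) (a m' n') \<oplus>\<^bsub>W\<^esub> f (b n' m') (a m n) = \<zero>\<^bsub>W\<^esub>"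
    and "\<And>m m' m'' n n' n''. \<lbrakk>m \<in> carrier M; m' \<in> carrier M; m'' \<in> carrier M;
          n \<in> carrier N; n' \<in> carrier N; n'' \<in> carrier N\<rbrakk> \<Longrightarrow>
        f \<lblot>b n m, b n' m'\<rblot>\<^bsub>M\<^esub> (twist N (a m'' n''))
          \<oplus>\<^bsub>W\<^esub> f \<lblot>b n' m', b n'' m''\<rblot>\<^bsub>M\<^esub> (twist N (a m n))
          \<oplus>\<^bsub>W\<^esub> f \<lblot>b n'' m'', b n m\<rblot>\<^bsub>M\<^esub> (twist N (a m' n')) = \<zero>\<^bsub>W\<^esub>"
  shows "hom_pairing R M N a b W f"
  unfolding hom_pairing_def by (intro conjI ballI assms)

lemma hom_pairingD:
  assumes "hom_pairing R M N a b W f"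
  shows "bilinear_map R M N W f"
    and "\<And>m m' n. \<lbrakk>m \<in> carrier M; m' \<in> carrier M; n \<in> carrier N\<rbrakk> \<Longrightarrow>
        f \<lblot>m, m'\<rblot>\<^bsub>M\<^esub> (twist N n) \<ominus>\<^bsub>W\<^esub> f (twist M m) (a m' n) \<oplus>\<^bsub>W\<^esub> f (twist M m') (a m n) = \<zero>\<^bsub>W\<^esub>"
    and "\<And>m n n'. \<lbrakk>m \<in> carrier M; n \<in> carrier N; n' \<in> carrier N\<rbrakk> \<Longrightarrow>
        f (twist M m) \<lblot>n, n'\<rblot>\<^bsub>N\<^esub> \<ominus>\<^bsub>W\<^esub> f (b n' m) (twist N n) \<oplus>\<^bsub>W\<^esub> f (b n m) (twist N n') = \<zero>\<^bsub>W\<^esub>"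
    and "\<And>m n. \<lbrakk>m \<in> carrier M; n \<in> carrier N\<rbrakk> \<Longrightarrow> f (b n m) (a m n) = \<zero>\<^bsub>W\<^esub>"
    and "\<And>m m' n n'. \<lbrakk>m \<in> carrier M; m' \<in> carrier M; n \<in> carrier N; n' \<in> carrier N\<rbrakk> \<Longrightarrow>
        f (b n m) (a m' n') \<oplus>\<^bsub>W\<^esub> f (b n' m') (a m n) = \<zero>\<^bsub>W\<^esub>"
    and "\<And>m m' m'' n n' n''. \<lbrakk>m \<in> carrier M; m' \<in> carrier M; m'' \<in> carrier M;
          n \<in> carrier N; n' \<in> carrier N; n'' \<in> carrier N\<rbrakk> \<Longrightarrow>
        f \<lblot>b n m, b n' m'\<rblot>\<^bsub>M\<^esub> (twist N (a m'' n''))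
          \<oplus>\<^bsub>W\<^esub> f \<lblot>b n' m', b n'' m''\<rblot>\<^bsub>M\<^esub> (twist N (a m n))
          \<oplus>\<^bsub>W\<^esub> f \<lblot>b n'' m'', b n m\<rblot>\<^bsub>M\<^esub> (twist N (a m' n')) = \<zero>\<^bsub>W\<^esub>"
  using assms by (simp_all add: hom_pairing_def)

lemma star_relatorsI:
  fixes R M N
  defines "T \<equiv> tensor_module R M N" and "t \<equiv> pure_tensor R M N"
  shows "\<lbrakk>m \<in> carrier M; m' \<in> carrier M; n \<in> carrier N\<rbrakk> \<Longrightarrow>
        t \<lblot>m, m'\<rblot>\<^bsub>M\<^esub> (twist N n) \<ominus>\<^bsub>T\<^esub> t (twist M m) (a m' n) \<oplus>\<^bsub>T\<^esub> t (twist M m') (a m n)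
          \<in> star_relators R M N a b"
    and "\<lbrakk>m \<in> carrier M; n \<in> carrier N; n' \<in> carrier N\<rbrakk> \<Longrightarrow>
        t (twist M m) \<lblot>n, n'\<rblot>\<^bsub>N\<^esub> \<ominus>\<^bsub>T\<^esub> t (b n' m) (twist N n) \<oplus>\<^bsub>T\<^esub> t (b n m) (twist N n')
          \<in> star_relators R M N a b"
    and "\<lbrakk>m \<in> carrier M; n \<in> carrier N\<rbrakk> \<Longrightarrow> t (b n m) (a m n) \<in> star_relators R M N a b"
    and "\<lbrakk>m \<in> carrier M; m' \<in> carrier M; n \<in> carrier N; n' \<in> carrier N\<rbrakk> \<Longrightarrow>
        t (b n m) (a m' n') \<oplus>\<^bsub>T\<^esub> t (b n' m') (a m n) \<in> star_relators R M N a b"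
    and "\<lbrakk>m \<in> carrier M; m' \<in> carrier M; m'' \<in> carrier M;
          n \<in> carrier N; n' \<in> carrier N; n'' \<in> carrier N\<rbrakk> \<Longrightarrow>
        t \<lblot>b n m, b n' m'\<rblot>\<^bsub>M\<^esub> (twist N (a m'' n''))
          \<oplus>\<^bsub>T\<^esub> t \<lblot>b n' m', b n'' m''\<rblot>\<^bsub>M\<^esub> (twist N (a m n))
          \<oplus>\<^bsub>T\<^esub> t \<lblot>b n'' m'', b n m\<rblot>\<^bsub>M\<^esub> (twist N (a m' n')) \<in> star_relators R M N a b"
  unfolding star_relators_def Let_def T_def t_def by blast+

section \<open>Consequences of skew-symmetry and the Hom-Jacobi identity\<close>

context hom_lie_algebra
begin

lemma bracket_closed [simp]: "\<lbrakk>x \<in> carrier L; y \<in> carrier L\<rbrakk> \<Longrightarrow> \<lblot>x, y\<rblot> \<in> carrier L"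
  by (rule bilinear_map_closed[OF bracket_bilinear])

lemma twist_closed [simp]: "x \<in> carrier L \<Longrightarrow> twist L x \<in> carrier L"
  by (rule linear_map_closed[OF twist_linear])

lemma bracket_add_swap:
  "\<lbrakk>x \<in> carrier L; y \<in> carrier L\<rbrakk> \<Longrightarrow> \<lblot>x, y\<rblot> \<oplus>\<^bsub>L\<^esub> \<lblot>y, x\<rblot> = \<zero>\<^bsub>L\<^esub>"
  using bracket_skew[of x y] by (simp add: l_neg M.l_neg)

text \<open>Skew-symmetry gives twice the bracket equal to zero, and a nonzero 2 is invertible in a
  field.\<close>

lemma bracket_self:
  assumes "\<one>\<^bsub>R\<^esub> \<oplus>\<^bsub>R\<^esub> \<one>\<^bsub>R\<^esub> \<noteq> \<zero>\<^bsub>R\<^esub>" "x \<in> carrier L"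
  shows "\<lblot>x, x\<rblot> = \<zero>\<^bsub>L\<^esub>"
proof -
  let ?c = "inv\<^bsub>R\<^esub> (\<one>\<^bsub>R\<^esub> \<oplus>\<^bsub>R\<^esub> \<one>\<^bsub>R\<^esub>)"
  have unit: "\<one>\<^bsub>R\<^esub> \<oplus>\<^bsub>R\<^esub> \<one>\<^bsub>R\<^esub> \<in> Units R" using assms(1) field_Units by simp
  have "(\<one>\<^bsub>R\<^esub> \<oplus>\<^bsub>R\<^esub> \<one>\<^bsub>R\<^esub>) \<odot>\<^bsub>L\<^esub> \<lblot>x, x\<rblot> = \<zero>\<^bsub>L\<^esub>"
    using bracket_add_swap[of x x] assms(2) by (simp add: smult_l_distr)
  then have "?c \<odot>\<^bsub>L\<^esub> ((\<one>\<^bsub>R\<^esub> \<oplus>\<^bsub>R\<^esub> \<one>\<^bsub>R\<^esub>) \<odot>\<^bsub>L\<^esub> \<lblot>x, x\<rblot>) = \<zero>\<^bsub>L\<^esub>"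
    using unit by simp
  then show ?thesis
    using unit assms(2) by (simp add: smult_assoc1[symmetric] Units_l_inv)
qed

text \<open>The Hom-Jacobi identity with the twisted entry on the right, one use of skew-symmetry
  per summand. Relator (v) takes this form under the action \<open>b\<close>.\<close>

lemma hom_jacobi_left:
  assumes "x \<in> carrier L" "y \<in> carrier L" "z \<in> carrier L"
  shows "\<lblot>\<lblot>x, y\<rblot>, twist L z\<rblot> \<oplus>\<^bsub>L\<^esub> \<lblot>\<lblot>y, z\<rblot>, twist L x\<rblot> \<oplus>\<^bsub>L\<^esub> \<lblot>\<lblot>z, x\<rblot>, twist L y\<rblot> = \<zero>\<^bsub>L\<^esub>"
proof -
  have *: "\<lblot>\<lblot>u, v\<rblot>, twist L w\<rblot> = \<ominus>\<^bsub>L\<^esub> \<lblot>twist L w, \<lblot>u, v\<rblot>\<rblot>"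
    if "u \<in> carrier L" "v \<in> carrier L" "w \<in> carrier L" for u v w
    using that by (intro bracket_skew) simp_all
  have "\<lblot>\<lblot>x, y\<rblot>, twist L z\<rblot> \<oplus>\<^bsub>L\<^esub> \<lblot>\<lblot>y, z\<rblot>, twist L x\<rblot> \<oplus>\<^bsub>L\<^esub> \<lblot>\<lblot>z, x\<rblot>, twist L y\<rblot> =
    \<ominus>\<^bsub>L\<^esub> (\<lblot>twist L z, \<lblot>x, y\<rblot>\<rblot> \<oplus>\<^bsub>L\<^esub> \<lblot>twist L x, \<lblot>y, z\<rblot>\<rblot> \<oplus>\<^bsub>L\<^esub> \<lblot>twist L y, \<lblot>z, x\<rblot>\<rblot>)"
    using assms by (simp add: * M.minus_add)
  also have "\<lblot>twist L z, \<lblot>x, y\<rblot>\<rblot> \<oplus>\<^bsub>L\<^esub> \<lblot>twist L x, \<lblot>y, z\<rblot>\<rblot> \<oplus>\<^bsub>L\<^esub> \<lblot>twist L y, \<lblot>z, x\<rblot>\<rblot> = \<zero>\<^bsub>L\<^esub>"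
    using hom_jacobi[OF assms] assms by (simp add: M.a_ac)
  finally show ?thesis by simp
qed

end

locale hom_action_pair = M: hom_lie_algebra R M + N: hom_lie_algebra R N
  for R :: "('k, 'r) ring_scheme" and M :: "('k, 'm, 'mz) hom_lie_scheme"
    and N :: "('k, 'n, 'nz) hom_lie_scheme" +
  fixes a :: "'m \<Rightarrow> 'n \<Rightarrow> 'n" and b :: "'n \<Rightarrow> 'm \<Rightarrow> 'm"
  assumes compatible: "compatible_hom_actions R M N a b"
begin

sublocale module_pair R M N
  by (intro module_pair.intro M.module_axioms N.module_axioms)

lemma a_bilinear: "bilinear_map R M N N a"
  and b_bilinear: "bilinear_map R N M M b"
  using compatible unfolding compatible_hom_actions_def hom_action_def by blast+

lemma a_bracket_left:
    "\<lbrakk>x \<in> carrier M; y \<in> carrier M; n \<in> carrier N\<rbrakk> \<Longrightarrow>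
      a \<lblot>x, y\<rblot>\<^bsub>M\<^esub> (twist N n) = a (twist M x) (a y n) \<ominus>\<^bsub>N\<^esub> a (twist M y) (a x n)"
  and a_bracket_right:
    "\<lbrakk>x \<in> carrier M; n \<in> carrier N; n' \<in> carrier N\<rbrakk> \<Longrightarrow>
      a (twist M x) \<lblot>n, n'\<rblot>\<^bsub>N\<^esub> = \<lblot>a x n, twist N n'\<rblot>\<^bsub>N\<^esub> \<oplus>\<^bsub>N\<^esub> \<lblot>twist N n, a x n'\<rblot>\<^bsub>N\<^esub>"
  and twist_a: "\<lbrakk>x \<in> carrier M; n \<in> carrier N\<rbrakk> \<Longrightarrow> twist N (a x n) = a (twist M x) (twist N n)"
  and b_bracket_left:
    "\<lbrakk>k \<in> carrier N; l \<in> carrier N; m \<in> carrier M\<rbrakk> \<Longrightarrow>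
      b \<lblot>k, l\<rblot>\<^bsub>N\<^esub> (twist M m) = b (twist N k) (b l m) \<ominus>\<^bsub>M\<^esub> b (twist N l) (b k m)"
  and b_bracket_right:
    "\<lbrakk>k \<in> carrier N; m \<in> carrier M; m' \<in> carrier M\<rbrakk> \<Longrightarrow>
      b (twist N k) \<lblot>m, m'\<rblot>\<^bsub>M\<^esub> = \<lblot>b k m, twist M m'\<rblot>\<^bsub>M\<^esub> \<oplus>\<^bsub>M\<^esub> \<lblot>twist M m, b k m'\<rblot>\<^bsub>M\<^esub>"
  and twist_b: "\<lbrakk>k \<in> carrier N; m \<in> carrier M\<rbrakk> \<Longrightarrow> twist M (b k m) = b (twist N k) (twist M m)"
  and b_a: "\<lbrakk>m \<in> carrier M; m' \<in> carrier M; n \<in> carrier N\<rbrakk> \<Longrightarrow> b (a m n) m' = \<lblot>m', b n m\<rblot>\<^bsub>M\<^esub>"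
  and a_b: "\<lbrakk>m \<in> carrier M; n \<in> carrier N; n' \<in> carrier N\<rbrakk> \<Longrightarrow> a (b n m) n' = \<lblot>n', a m n\<rblot>\<^bsub>N\<^esub>"
  using compatible by (simp_all add: compatible_hom_actions_def hom_action_def)

lemma a_closed [simp]: "\<lbrakk>m \<in> carrier M; n \<in> carrier N\<rbrakk> \<Longrightarrow> a m n \<in> carrier N"
  by (rule bilinear_map_closed[OF a_bilinear])

lemma b_closed [simp]: "\<lbrakk>m \<in> carrier M; n \<in> carrier N\<rbrakk> \<Longrightarrow> b n m \<in> carrier M"
  by (rule bilinear_map_closed[OF b_bilinear])

abbreviation "S \<equiv> star R M N a b"
abbreviation "s \<equiv> star_elem R M N a b"
abbreviation "S\<^sub>0 \<equiv> star_space R M N a b"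

interpretation T: module R T
  by (rule tensor_is_module)

lemma t_closed [simp]: "\<lbrakk>m \<in> carrier M; n \<in> carrier N\<rbrakk> \<Longrightarrow> t m n \<in> carrier T"
  by (rule bilinear_map_closed[OF pure_tensor_bilinear])

lemma star_relators_closed: "star_relators R M N a b \<subseteq> carrier T"
  unfolding star_relators_def Let_def by auto

interpretation ST: module_quotient R T "star_kernel R M N a b"
  unfolding module_quotient_def module_quotient_axioms_def star_kernel_def
  by (intro conjI T.module_axioms submodule_subspace_span star_relators_closed)

lemma star_space_is_module: "module R S\<^sub>0"
  unfolding star_space_def by (rule ST.quotient_is_module)

lemma star_projection_linear: "linear_map R T S\<^sub>0 (\<lambda>x. star_kernel R M N a b +>\<^bsub>T\<^esub> x)"
  unfolding star_space_def by (rule ST.linear_coset)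

lemma star_projection_relator:
  assumes "x \<in> star_relators R M N a b"
  shows "star_kernel R M N a b +>\<^bsub>T\<^esub> x = \<zero>\<^bsub>S\<^sub>0\<^esub>"
proof -
  have "x \<in> star_kernel R M N a b"
    unfolding star_kernel_def using assms by (rule subsetD[OF subspace_span_superset])
  then show ?thesis
    by (simp add: star_space_def ST.a_rcos_const)
qed

text \<open>By linearity of the projection, the left side of each relation is the coset of a
  relator, hence zero.\<close>

lemma star_elem_pairing0: "hom_pairing R M N a b S\<^sub>0 s"
proof (rule hom_pairingI)
  show "bilinear_map R M N S\<^sub>0 s"
    unfolding star_elem_def
    by (rule bilinear_map_comp[OF pure_tensor_bilinear linear_map_id linear_map_id
          star_projection_linear])
qed (unfold star_elem_def,
    simp_all add: star_projection_relator[OF star_relatorsI(1)] star_projection_relator[OF star_relatorsI(2)]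
      star_projection_relator[OF star_relatorsI(3)] star_projection_relator[OF star_relatorsI(4)]
      star_projection_relator[OF star_relatorsI(5)]
      linear_map_add[OF star_projection_linear, symmetric]
      linear_map_minus[OF star_projection_linear T.module_axioms star_space_is_module, symmetric])

lemma star_generated0:
  "carrier S\<^sub>0 \<subseteq> subspace_span R S\<^sub>0 {s m n | m n. m \<in> carrier M \<and> n \<in> carrier N}"
proof -
  let ?B = "{t m n | m n. m \<in> carrier M \<and> n \<in> carrier N}"
  have "carrier S\<^sub>0 \<subseteq> subspace_span R S\<^sub>0 ((\<lambda>x. star_kernel R M N a b +>\<^bsub>T\<^esub> x) ` ?B)"
    unfolding star_space_def
    by (rule span_image[OF T.module_axioms ST.quotient_is_module ST.linear_coset ST.coset_image
          tensor_generated]) auto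
  moreover have "(\<lambda>x. star_kernel R M N a b +>\<^bsub>T\<^esub> x) ` ?B =
      {s m n | m n. m \<in> carrier M \<and> n \<in> carrier N}"
    unfolding star_elem_def by blast
  ultimately show ?thesis by simp
qed

text \<open>The lift to the tensor product sends the relators to the left sides of the conditions in
  \<open>hom_pairing\<close>, so it factors through the quotient by their span.\<close>

lemma star_lift0:
  assumes "module R U" "hom_pairing R M N a b U f"
  obtains g where "linear_map R S\<^sub>0 U g"
    "\<And>m n. \<lbrakk>m \<in> carrier M; n \<in> carrier N\<rbrakk> \<Longrightarrow> g (s m n) = f m n"
proof -
  interpret U: module R U by fact
  note f = hom_pairingD[OF assms(2)]
  obtain h where h: "linear_map R T U h"
    and ht: "\<And>m n. \<lbrakk>m \<in> carrier M; n \<in> carrier N\<rbrakk> \<Longrightarrow> h (t m n) = f m n"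
    using tensor_lift[OF assms(1) f(1)] by metis
  have "h x = \<zero>\<^bsub>U\<^esub>" if "x \<in> star_relators R M N a b" for x
    using that unfolding star_relators_def Let_def
    by (auto simp: linear_map_minus[OF h T.module_axioms assms(1)] linear_map_add[OF h] ht f(2-))
  then have "h x = \<zero>\<^bsub>U\<^esub>" if "x \<in> star_kernel R M N a b" for x
    using linear_map_vanishes_on_span[OF T.module_axioms assms(1) h star_relators_closed] that
    unfolding star_kernel_def by blast
  then obtain g where "linear_map R S\<^sub>0 U g"
    "\<And>x. x \<in> carrier T \<Longrightarrow> g (star_kernel R M N a b +>\<^bsub>T\<^esub> x) = h x"
    using ST.quotient_lift[OF assms(1) h] unfolding star_space_def by metis
  then show ?thesis
    using that ht t_closed unfolding star_elem_def by metis
qed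

end

section \<open>Passage from the quotient space to the Hom-Lie record \<open>star\<close>\<close>

lemma star_simps:
  "carrier (star R M N a b) = carrier (star_space R M N a b)"
  "\<zero>\<^bsub>star R M N a b\<^esub> = \<zero>\<^bsub>star_space R M N a b\<^esub>"
  "x \<oplus>\<^bsub>star R M N a b\<^esub> y = x \<oplus>\<^bsub>star_space R M N a b\<^esub> y"
  "c \<odot>\<^bsub>star R M N a b\<^esub> x = c \<odot>\<^bsub>star_space R M N a b\<^esub> x"
  "bracket (star R M N a b) = (SOME B. is_star_bracket R M N a b B)"
  "twist (star R M N a b) = (SOME A. is_star_twist R M N a b A)"
  unfolding star_def by (simp_all add: module.defs hom_lie.defs)

lemma star_minus: "\<ominus>\<^bsub>star R M N a b\<^esub> x = \<ominus>\<^bsub>star_space R M N a b\<^esub> x"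
  by (simp add: a_inv_def m_inv_def star_simps)

text \<open>Linearity reads only carrier, addition and scalar multiplication, which the two records
  share; so the universal property passes from \<open>star_space\<close> to \<open>star\<close>
  whatever bracket and twist were selected.\<close>

lemma linear_map_star:
  "linear_map R (star_space R M N a b) U f \<longleftrightarrow> linear_map R (star R M N a b) U f"
  "linear_map R V (star_space R M N a b) g \<longleftrightarrow> linear_map R V (star R M N a b) g"
  by (simp_all add: linear_map_def star_simps)

lemma is_star_bracket_iff:
  "is_star_bracket R M N a b B \<longleftrightarrow>
    bilinear_map R (star R M N a b) (star R M N a b) (star R M N a b) B \<and>
    (\<forall>m\<in>carrier M. \<forall>m'\<in>carrier M. \<forall>n\<in>carrier N. \<forall>n'\<in>carrier N.
      B (star_elem R M N a b m n) (star_elem R M N a b m' n')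
        = \<ominus>\<^bsub>star R M N a b\<^esub> star_elem R M N a b (b n m) (a m' n'))"
  unfolding is_star_bracket_def Let_def star_minus linear_map_star bilinear_map_def by (simp add: star_simps)

lemma is_star_twist_iff:
  "is_star_twist R M N a b A \<longleftrightarrow> linear_map R (star R M N a b) (star R M N a b) A \<and>
    (\<forall>m\<in>carrier M. \<forall>n\<in>carrier N.
      A (star_elem R M N a b m n) = star_elem R M N a b (twist M m) (twist N n))"
  unfolding is_star_twist_def Let_def linear_map_star ..

context hom_action_pair
begin

lemma star_is_module: "module R S"
  by (rule module_cong[OF star_space_is_module]) (simp_all add: star_simps)

sublocale S: module R S
  by (rule star_is_module)

lemma star_elem_pairing: "hom_pairing R M N a b S s"
  using star_elem_pairing0 unfolding hom_pairing_def bilinear_map_def linear_map_star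
  by (simp add: a_minus_def star_minus star_simps)

lemma star_generated: "carrier S \<subseteq> subspace_span R S {s m n | m n. m \<in> carrier M \<and> n \<in> carrier N}"
  using star_generated0
  unfolding subspace_span_def submodule_iff[OF star_is_module] submodule_iff[OF star_space_is_module]
  by (simp add: star_simps)

lemma star_lift:
  assumes "module R U" "hom_pairing R M N a b U f"
  obtains g where "linear_map R S U g"
    "\<And>m n. \<lbrakk>m \<in> carrier M; n \<in> carrier N\<rbrakk> \<Longrightarrow> g (s m n) = f m n"
  using star_lift0[OF assms] unfolding linear_map_star by metis

lemmas s_bilinear = hom_pairingD(1)[OF star_elem_pairing]
lemmas s_relations = hom_pairingD(2-)[OF star_elem_pairing]

lemma s_closed [simp]: "\<lbrakk>m \<in> carrier M; n \<in> carrier N\<rbrakk> \<Longrightarrow> s m n \<in> carrier S"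
  by (rule bilinear_map_closed[OF s_bilinear])

lemma star_subset_submodule:
  assumes "submodule W R S" "\<And>m n. \<lbrakk>m \<in> carrier M; n \<in> carrier N\<rbrakk> \<Longrightarrow> s m n \<in> W"
  shows "carrier S \<subseteq> W"
proof (rule order_trans[OF star_generated subspace_span_minimal[OF assms(1)]])
  show "{s m n | m n. m \<in> carrier M \<and> n \<in> carrier N} \<subseteq> W" using assms(2) by blast
qed

lemma star_ext:
  assumes "module R U" "linear_map R S U f" "linear_map R S U g"
    and "\<And>m n. \<lbrakk>m \<in> carrier M; n \<in> carrier N\<rbrakk> \<Longrightarrow> f (s m n) = g (s m n)"
    and "x \<in> carrier S"
  shows "f x = g x"
  using star_subset_submodule[OF submodule_equalizer[OF star_is_module assms(1-3)]] assms(4,5)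
  by auto

text \<open>One argument at a time: \<open>y\<close> is held fixed while \<open>x\<close> is reduced
  to a generator, and then \<open>y\<close> is reduced.\<close>

lemma star_ext2:
  assumes "module R U" "bilinear_map R S S U f" "bilinear_map R S S U g"
    and "\<And>m n m' n'. \<lbrakk>m \<in> carrier M; n \<in> carrier N; m' \<in> carrier M; n' \<in> carrier N\<rbrakk> \<Longrightarrow>
      f (s m n) (s m' n') = g (s m n) (s m' n')"
    and "x \<in> carrier S" "y \<in> carrier S"
  shows "f x y = g x y"
proof (rule star_ext[OF assms(1) bilinear_map_left[OF assms(2,6)] bilinear_map_left[OF assms(3,6)] _ assms(5)])
  fix m n assume mn: "m \<in> carrier M" "n \<in> carrier N"
  show "f (s m n) y = g (s m n) y"
    by (rule star_ext[OF assms(1) bilinear_map_right[OF assms(2)] bilinear_map_right[OF assms(3)] _ assms(6)])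
      (simp_all add: mn assms(4))
qed

text \<open>Multiplicativity of the twists and equivariance of the actions turn each relation at
  twisted arguments into an instance of the same relation, so the prescribed values extend linearly
  and the selected twist has them.\<close>

lemma star_twist: "is_star_twist R M N a b (twist S)"
proof -
  have "hom_pairing R M N a b S (\<lambda>m n. s (twist M m) (twist N n))"
  proof (rule hom_pairingI)
    show "bilinear_map R M N S (\<lambda>m n. s (twist M m) (twist N n))"
      by (rule bilinear_map_comp[OF s_bilinear M.twist_linear N.twist_linear linear_map_id])
    fix m m' m'' n n' n''
    assume "m \<in> carrier M" "m' \<in> carrier M" "m'' \<in> carrier M"
      and "n \<in> carrier N" "n' \<in> carrier N" "n'' \<in> carrier N"
    then show "s (twist M \<lblot>b n m, b n' m'\<rblot>\<^bsub>M\<^esub>) (twist N (twist N (a m'' n''))) \<oplus>\<^bsub>S\<^esub>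
        s (twist M \<lblot>b n' m', b n'' m''\<rblot>\<^bsub>M\<^esub>) (twist N (twist N (a m n))) \<oplus>\<^bsub>S\<^esub>
        s (twist M \<lblot>b n'' m'', b n m\<rblot>\<^bsub>M\<^esub>) (twist N (twist N (a m' n'))) = \<zero>\<^bsub>S\<^esub>"
      \<comment> \<open>Relation (v) contains \<open>twist N (a m n)\<close>, which
        \<open>twist_a\<close> rewrites; the instance is supplied explicitly so that it is rewritten
        in the same way as the goal.\<close>
      using s_relations(5)[of "twist M m" "twist M m'" "twist M m''" "twist N n" "twist N n'" "twist N n''"]
      by (simp add: M.twist_multiplicative twist_a twist_b)
  qed (simp_all add: M.twist_multiplicative N.twist_multiplicative twist_a twist_b s_relations)
  then have "\<exists>A. is_star_twist R M N a b A"
    unfolding is_star_twist_iff using star_lift[OF star_is_module] by metis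
  then show ?thesis
    unfolding star_simps by (rule someI_ex)
qed

lemma twist_linear: "linear_map R S S (twist S)"
  and twist_s: "\<lbrakk>m \<in> carrier M; n \<in> carrier N\<rbrakk> \<Longrightarrow> twist S (s m n) = s (twist M m) (twist N n)"
  using star_twist unfolding is_star_twist_iff by blast+

text \<open>The prescribed value depends on the first generator only through \<open>b n m\<close>
  and on the second only through \<open>a m' n'\<close>. The bilinear extension problem thus splits
  into two linear ones, one for each action.\<close>

lemma star_bracket_exists:
  assumes "\<one>\<^bsub>R\<^esub> \<oplus>\<^bsub>R\<^esub> \<one>\<^bsub>R\<^esub> \<noteq> \<zero>\<^bsub>R\<^esub>"
  shows "star_defined R M N a b"
proof -
  have "hom_pairing R M N a b M (\<lambda>m n. b n m)"
  proof (rule hom_pairingI)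
    show "bilinear_map R M N M (\<lambda>m n. b n m)"
      using b_bilinear unfolding bilinear_map_def by blast
  next
    fix m m' n assume "m \<in> carrier M" "m' \<in> carrier M" "n \<in> carrier N"
    then show "b (twist N n) \<lblot>m, m'\<rblot>\<^bsub>M\<^esub> \<ominus>\<^bsub>M\<^esub> b (a m' n) (twist M m) \<oplus>\<^bsub>M\<^esub> b (a m n) (twist M m') = \<zero>\<^bsub>M\<^esub>"
      by (simp add: b_bracket_right b_a M.M.cancel_outer M.bracket_add_swap)
  next
    fix m n n' assume "m \<in> carrier M" "n \<in> carrier N" "n' \<in> carrier N"
    then show "b \<lblot>n, n'\<rblot>\<^bsub>N\<^esub> (twist M m) \<ominus>\<^bsub>M\<^esub> b (twist N n) (b n' m) \<oplus>\<^bsub>M\<^esub> b (twist N n') (b n m) = \<zero>\<^bsub>M\<^esub>"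
      by (simp add: b_bracket_left M.M.cancel_inner)
  next
    fix m m' m'' n n' n''
    assume "m \<in> carrier M" "m' \<in> carrier M" "m'' \<in> carrier M"
      and "n \<in> carrier N" "n' \<in> carrier N" "n'' \<in> carrier N"
    \<comment> \<open>By compatibility each summand is the bracket of
      \<open>\<lblot>b n m, b n' m'\<rblot>\<close> with the twist of the third element
      \<open>b n'' m''\<close>, cyclically, so the sum is a Hom-Jacobi sum in
      \<open>M\<close>.\<close>
    then show "b (twist N (a m'' n'')) \<lblot>b n m, b n' m'\<rblot>\<^bsub>M\<^esub> \<oplus>\<^bsub>M\<^esub>
        b (twist N (a m n)) \<lblot>b n' m', b n'' m''\<rblot>\<^bsub>M\<^esub> \<oplus>\<^bsub>M\<^esub>
        b (twist N (a m' n')) \<lblot>b n'' m'', b n m\<rblot>\<^bsub>M\<^esub> = \<zero>\<^bsub>M\<^esub>"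
      by (simp add: twist_a b_a twist_b[symmetric] M.hom_jacobi_left)
  \<comment> \<open>Relations (iii) and (iv) remain: by compatibility they become the bracket of
    \<open>b n m\<close> with itself and a sum of two opposite brackets.\<close>
  qed (simp_all add: b_a M.bracket_self[OF assms] M.bracket_add_swap)
  then obtain \<beta> where lam: "linear_map R S M \<beta>"
    and lam_s: "\<And>m n. \<lbrakk>m \<in> carrier M; n \<in> carrier N\<rbrakk> \<Longrightarrow> \<beta> (s m n) = b n m"
    using star_lift[OF M.module_axioms] by metis
  have "hom_pairing R M N a b N a"
  proof (rule hom_pairingI)
    show "bilinear_map R M N N a" by (rule a_bilinear)
  next
    fix m m' n assume "m \<in> carrier M" "m' \<in> carrier M" "n \<in> carrier N"
    then show "a \<lblot>m, m'\<rblot>\<^bsub>M\<^esub> (twist N n) \<ominus>\<^bsub>N\<^esub> a (twist M m) (a m' n) \<oplus>\<^bsub>N\<^esub> a (twist M m') (a m n) = \<zero>\<^bsub>N\<^esub>"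
      by (simp add: a_bracket_left N.M.cancel_inner)
  next
    fix m n n' assume "m \<in> carrier M" "n \<in> carrier N" "n' \<in> carrier N"
    then show "a (twist M m) \<lblot>n, n'\<rblot>\<^bsub>N\<^esub> \<ominus>\<^bsub>N\<^esub> a (b n' m) (twist N n) \<oplus>\<^bsub>N\<^esub> a (b n m) (twist N n') = \<zero>\<^bsub>N\<^esub>"
      by (simp add: a_bracket_right a_b N.M.cancel_outer N.bracket_add_swap)
  next
    fix m m' m'' n n' n''
    assume *: "m \<in> carrier M" "m' \<in> carrier M" "m'' \<in> carrier M"
      "n \<in> carrier N" "n' \<in> carrier N" "n'' \<in> carrier N"
    \<comment> \<open>Compatibility is used three times: it turns the bracket in \<open>M\<close>
      into an action of \<open>a y l\<close>, and then both remaining actions of elements of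
      \<open>M\<close> into brackets in \<open>N\<close>. Relation (v) becomes a Hom-Jacobi sum in
      \<open>N\<close>.\<close>
    have "a \<lblot>b k x, b l y\<rblot>\<^bsub>M\<^esub> (twist N z) = \<lblot>twist N z, \<lblot>a y l, a x k\<rblot>\<^bsub>N\<^esub>\<rblot>\<^bsub>N\<^esub>"
      if "x \<in> carrier M" "y \<in> carrier M" "k \<in> carrier N" "l \<in> carrier N" "z \<in> carrier N" for x y k l z
      using that by (simp add: b_a[symmetric] a_b)
    then show "a \<lblot>b n m, b n' m'\<rblot>\<^bsub>M\<^esub> (twist N (a m'' n'')) \<oplus>\<^bsub>N\<^esub>
        a \<lblot>b n' m', b n'' m''\<rblot>\<^bsub>M\<^esub> (twist N (a m n)) \<oplus>\<^bsub>N\<^esub>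
        a \<lblot>b n'' m'', b n m\<rblot>\<^bsub>M\<^esub> (twist N (a m' n')) = \<zero>\<^bsub>N\<^esub>"
      using * by (simp add: N.hom_jacobi)
  qed (simp_all add: a_b N.bracket_self[OF assms] N.bracket_add_swap)
  then obtain \<alpha> where mu: "linear_map R S N \<alpha>"
    and mu_s: "\<And>m n. \<lbrakk>m \<in> carrier M; n \<in> carrier N\<rbrakk> \<Longrightarrow> \<alpha> (s m n) = a m n"
    using star_lift[OF N.module_axioms] by metis
  have "bilinear_map R S S S (\<lambda>x y. \<ominus>\<^bsub>S\<^esub> s (\<beta> x) (\<alpha> y))"
    by (rule bilinear_map_comp[OF s_bilinear lam mu linear_map_uminus[OF star_is_module linear_map_id]])
  then have "is_star_bracket R M N a b (\<lambda>x y. \<ominus>\<^bsub>S\<^esub> s (\<beta> x) (\<alpha> y))"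
    unfolding is_star_bracket_iff by (simp add: lam_s mu_s)
  then show ?thesis unfolding star_defined_def by blast
qed

end

section \<open>The Hom-Lie axioms for the tensor product, once a bracket exists\<close>

locale hom_star = hom_action_pair +
  assumes defined: "star_defined R M N a b"
begin

lemma star_bracket: "is_star_bracket R M N a b (bracket S)"
  using someI_ex[OF defined[unfolded star_defined_def]] unfolding star_simps .

lemma bracket_bilinear: "bilinear_map R S S S (bracket S)"
  and bracket_s: "\<lbrakk>m \<in> carrier M; m' \<in> carrier M; n \<in> carrier N; n' \<in> carrier N\<rbrakk> \<Longrightarrow>
    \<lblot>s m n, s m' n'\<rblot>\<^bsub>S\<^esub> = \<ominus>\<^bsub>S\<^esub> s (b n m) (a m' n')"
  using star_bracket unfolding is_star_bracket_iff by blast+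

lemma star_bracket_closed: "\<lbrakk>x \<in> carrier S; y \<in> carrier S\<rbrakk> \<Longrightarrow> \<lblot>x, y\<rblot>\<^bsub>S\<^esub> \<in> carrier S"
  by (rule bilinear_map_closed[OF bracket_bilinear])

lemma star_twist_closed: "x \<in> carrier S \<Longrightarrow> twist S x \<in> carrier S"
  by (rule linear_map_closed[OF twist_linear])

text \<open>On generators this is relation (iv), and both sides are bilinear.\<close>

lemma star_bracket_skew:
  assumes "x \<in> carrier S" "y \<in> carrier S"
  shows "\<lblot>x, y\<rblot>\<^bsub>S\<^esub> = \<ominus>\<^bsub>S\<^esub> \<lblot>y, x\<rblot>\<^bsub>S\<^esub>"
proof (rule star_ext2[OF star_is_module bracket_bilinear _ _ assms])
  show "bilinear_map R S S S (\<lambda>x y. \<ominus>\<^bsub>S\<^esub> \<lblot>y, x\<rblot>\<^bsub>S\<^esub>)"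
    using bilinear_map_comp[OF bracket_bilinear linear_map_id linear_map_id
        linear_map_uminus[OF star_is_module linear_map_id]]
    by (subst bilinear_map_swap)
  fix m n m' n' assume *: "m \<in> carrier M" "n \<in> carrier N" "m' \<in> carrier M" "n' \<in> carrier N"
  then have "\<ominus>\<^bsub>S\<^esub> s (b n m) (a m' n') = s (b n' m') (a m n)"
    by (intro S.minus_equality) (simp_all add: s_relations(4))
  then show "\<lblot>s m n, s m' n'\<rblot>\<^bsub>S\<^esub> = \<ominus>\<^bsub>S\<^esub> \<lblot>s m' n', s m n\<rblot>\<^bsub>S\<^esub>"
    using * by (simp add: bracket_s)
qed

lemma star_twist_bracket:
  assumes "x \<in> carrier S" "y \<in> carrier S"
  shows "twist S \<lblot>x, y\<rblot>\<^bsub>S\<^esub> = \<lblot>twist S x, twist S y\<rblot>\<^bsub>S\<^esub>"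
proof (rule star_ext2[OF star_is_module _ _ _ assms])
  show "bilinear_map R S S S (\<lambda>x y. twist S \<lblot>x, y\<rblot>\<^bsub>S\<^esub>)"
    by (rule bilinear_map_comp[OF bracket_bilinear linear_map_id linear_map_id twist_linear])
  show "bilinear_map R S S S (\<lambda>x y. \<lblot>twist S x, twist S y\<rblot>\<^bsub>S\<^esub>)"
    by (rule bilinear_map_comp[OF bracket_bilinear twist_linear twist_linear linear_map_id])
  fix m n m' n' assume *: "m \<in> carrier M" "n \<in> carrier N" "m' \<in> carrier M" "n' \<in> carrier N"
  then show "twist S \<lblot>s m n, s m' n'\<rblot>\<^bsub>S\<^esub> = \<lblot>twist S (s m n), twist S (s m' n')\<rblot>\<^bsub>S\<^esub>"
    by (simp add: bracket_s twist_s linear_map_neg[OF twist_linear star_is_module star_is_module]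
        twist_a twist_b)
qed

text \<open>On three generators this is relation (v). The Jacobi sum \<open>J\<close> is invariant
  under cyclic shifts, so linearity in its first argument suffices to free all three.\<close>

lemma star_jacobi:
  assumes "x \<in> carrier S" "y \<in> carrier S" "z \<in> carrier S"
  shows "\<lblot>twist S x, \<lblot>y, z\<rblot>\<^bsub>S\<^esub>\<rblot>\<^bsub>S\<^esub> \<oplus>\<^bsub>S\<^esub> \<lblot>twist S z, \<lblot>x, y\<rblot>\<^bsub>S\<^esub>\<rblot>\<^bsub>S\<^esub> \<oplus>\<^bsub>S\<^esub> \<lblot>twist S y, \<lblot>z, x\<rblot>\<^bsub>S\<^esub>\<rblot>\<^bsub>S\<^esub> = \<zero>\<^bsub>S\<^esub>"
proof -
  define J where "J x y z = \<lblot>twist S x, \<lblot>y, z\<rblot>\<^bsub>S\<^esub>\<rblot>\<^bsub>S\<^esub> \<oplus>\<^bsub>S\<^esub> \<lblot>twist S z, \<lblot>x, y\<rblot>\<^bsub>S\<^esub>\<rblot>\<^bsub>S\<^esub> \<oplus>\<^bsub>S\<^esub> \<lblot>twist S y, \<lblot>z, x\<rblot>\<^bsub>S\<^esub>\<rblot>\<^bsub>S\<^esub>"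
    for x y z
  have J_cyc: "J x y z = J y z x" if "x \<in> carrier S" "y \<in> carrier S" "z \<in> carrier S" for x y z
    using that by (simp add: J_def S.a_ac star_twist_closed star_bracket_closed)
  have lin: "linear_map R S S (\<lambda>x. J x y z)" if yz: "y \<in> carrier S" "z \<in> carrier S" for y z
    unfolding J_def
    by (intro linear_map_plus[OF star_is_module]
        linear_map_comp[OF bilinear_map_left[OF bracket_bilinear yz(1)] bilinear_map_right[OF bracket_bilinear]]
        linear_map_comp[OF bilinear_map_right[OF bracket_bilinear yz(2)] bilinear_map_right[OF bracket_bilinear]]
        linear_map_comp[OF twist_linear bilinear_map_left[OF bracket_bilinear]]
        star_twist_closed star_bracket_closed yz)
  have ext: "J x y z = \<zero>\<^bsub>S\<^esub>"
    if "\<And>m n. \<lbrakk>m \<in> carrier M; n \<in> carrier N\<rbrakk> \<Longrightarrow> J (s m n) y z = \<zero>\<^bsub>S\<^esub>"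
      "x \<in> carrier S" "y \<in> carrier S" "z \<in> carrier S" for x y z
    by (rule star_ext[OF star_is_module lin[OF that(3,4)] linear_map_const_zero[OF star_is_module]
          that(1) that(2)])
  have J_s: "J (s m n) (s m' n') (s m'' n'') = \<zero>\<^bsub>S\<^esub>"
    if "m \<in> carrier M" "m' \<in> carrier M" "m'' \<in> carrier M"
      "n \<in> carrier N" "n' \<in> carrier N" "n'' \<in> carrier N" for m m' m'' n n' n''
  proof -
    \<comment> \<open>The inner bracket is moved to the left, because the left factor of a product
      of generators is formed by \<open>b\<close>; compatibility then turns that factor into a
      bracket in \<open>M\<close>, as in relator (v).\<close>
    have *: "\<lblot>twist S (s k x), \<lblot>s l y, s p z\<rblot>\<^bsub>S\<^esub>\<rblot>\<^bsub>S\<^esub> = \<ominus>\<^bsub>S\<^esub> s \<lblot>b y l, b z p\<rblot>\<^bsub>M\<^esub> (twist N (a k x))"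
      if "k \<in> carrier M" "l \<in> carrier M" "p \<in> carrier M" "x \<in> carrier N" "y \<in> carrier N" "z \<in> carrier N"
      for k l p x y z
    proof -
      have "\<lblot>twist S (s k x), \<lblot>s l y, s p z\<rblot>\<^bsub>S\<^esub>\<rblot>\<^bsub>S\<^esub> = \<ominus>\<^bsub>S\<^esub> \<lblot>\<lblot>s l y, s p z\<rblot>\<^bsub>S\<^esub>, twist S (s k x)\<rblot>\<^bsub>S\<^esub>"
        using that by (intro star_bracket_skew star_twist_closed star_bracket_closed s_closed)
      also have "\<dots> = \<lblot>s (b y l) (a p z), s (twist M k) (twist N x)\<rblot>\<^bsub>S\<^esub>"
        using that by (simp add: bracket_s twist_s star_bracket_closed
            linear_map_neg[OF bilinear_map_left[OF bracket_bilinear] star_is_module star_is_module])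
      also have "\<dots> = \<ominus>\<^bsub>S\<^esub> s \<lblot>b y l, b z p\<rblot>\<^bsub>M\<^esub> (twist N (a k x))"
        using that by (simp add: bracket_s b_a twist_a)
      finally show ?thesis .
    qed
    have "J (s m n) (s m' n') (s m'' n'') =
        \<ominus>\<^bsub>S\<^esub> (s \<lblot>b n m, b n' m'\<rblot>\<^bsub>M\<^esub> (twist N (a m'' n'')) \<oplus>\<^bsub>S\<^esub>
          s \<lblot>b n' m', b n'' m''\<rblot>\<^bsub>M\<^esub> (twist N (a m n)) \<oplus>\<^bsub>S\<^esub>
          s \<lblot>b n'' m'', b n m\<rblot>\<^bsub>M\<^esub> (twist N (a m' n')))"
      using that by (simp add: J_def * S.minus_add S.a_ac)
    then show ?thesis using that by (simp add: s_relations(5))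
  qed
  \<comment> \<open>The arguments are freed in turn: \<open>1\<close> allows one arbitrary entry,
    \<open>2\<close> allows two, and the last step allows three. Between the steps a cyclic shift
    brings the next generator to the front.\<close>
  have 1: "J x (s m n) (s m' n') = \<zero>\<^bsub>S\<^esub>"
    if "m \<in> carrier M" "m' \<in> carrier M" "n \<in> carrier N" "n' \<in> carrier N" "x \<in> carrier S" for m m' n n' x
    by (rule ext) (simp_all add: that J_s)
  have 2: "J y (s m n) x = \<zero>\<^bsub>S\<^esub>" if "m \<in> carrier M" "n \<in> carrier N" "x \<in> carrier S" "y \<in> carrier S" for m n x y
  proof (rule ext[OF _ that(4) _ that(3)])
    fix m' n' assume "m' \<in> carrier M" "n' \<in> carrier N"
    then show "J (s m' n') (s m n) x = \<zero>\<^bsub>S\<^esub>"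
      using that 1 J_cyc[of x "s m' n'" "s m n"] by simp
  qed (simp add: that)
  have "J x y z = \<zero>\<^bsub>S\<^esub>"
  proof (rule ext[OF _ assms])
    fix m n assume "m \<in> carrier M" "n \<in> carrier N"
    then show "J (s m n) y z = \<zero>\<^bsub>S\<^esub>"
      using assms 2 J_cyc[of z "s m n" y] by simp
  qed
  then show ?thesis unfolding J_def .
qed

lemma star_is_hom_lie: "hom_lie_algebra R S"
  by (intro hom_lie_algebra.intro hom_lie_algebra_axioms.intro star_is_module M.field_axioms
      bracket_bilinear twist_linear star_bracket_skew star_jacobi star_twist_bracket)

end

section \<open>Functoriality\<close>

lemma hom_lie_homI:
  assumes "hom_lie_algebra R L" "hom_lie_algebra R L'" "linear_map R L L' f"
    and "\<And>x y. \<lbrakk>x \<in> carrier L; y \<in> carrier L\<rbrakk> \<Longrightarrow> f \<lblot>x, y\<rblot>\<^bsub>L\<^esub> = \<lblot>f x, f y\<rblot>\<^bsub>L'\<^esub>"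
    and "\<And>x. x \<in> carrier L \<Longrightarrow> f (twist L x) = twist L' (f x)"
  shows "f \<in> hom_lie_hom R L L'"
  using assms unfolding hom_lie_hom_def by simp

lemma hom_lie_homD:
  assumes "f \<in> hom_lie_hom R L L'"
  shows "linear_map R L L' f"
    and "\<lbrakk>x \<in> carrier L; y \<in> carrier L\<rbrakk> \<Longrightarrow> f \<lblot>x, y\<rblot>\<^bsub>L\<^esub> = \<lblot>f x, f y\<rblot>\<^bsub>L'\<^esub>"
    and "x \<in> carrier L \<Longrightarrow> f (twist L x) = twist L' (f x)"
  using assms unfolding hom_lie_hom_def by simp_all

lemma hom_pairing_comp:
  assumes f: "hom_pairing R M N a b V f" and "module R V" "module R W" "linear_map R V W g"
    and "hom_action_pair R M N a b"
  shows "hom_pairing R M N a b W (\<lambda>m n. g (f m n))"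
proof -
  interpret hom_action_pair R M N a b by fact
  interpret V: module R V by fact
  note fc = bilinear_map_closed[OF hom_pairingD(1)[OF f]]
  note hom = linear_map_add[OF assms(4), symmetric] linear_map_minus[OF assms(4,2,3), symmetric]
  show ?thesis
    by (rule hom_pairingI)
      (simp_all add: bilinear_map_comp[OF hom_pairingD(1)[OF f] linear_map_id linear_map_id assms(4)]
        hom fc hom_pairingD(2-)[OF f] linear_map_zero[OF assms(4,2,3)])
qed

text \<open>The data on which the tensor product is functorial: homomorphisms of both factors that
  intertwine both actions.\<close>

locale star_map = A: hom_action_pair R M N a b + B: hom_action_pair R M' N' a' b'
  for R M N a b M' N' a' b' +
  fixes p q
  assumes p_hom: "p \<in> hom_lie_hom R M M'" and q_hom: "q \<in> hom_lie_hom R N N'"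
    and q_a: "\<lbrakk>m \<in> carrier M; n \<in> carrier N\<rbrakk> \<Longrightarrow> q (a m n) = a' (p m) (q n)"
    and p_b: "\<lbrakk>m \<in> carrier M; n \<in> carrier N\<rbrakk> \<Longrightarrow> p (b n m) = b' (q n) (p m)"
begin

lemmas p_linear = hom_lie_homD(1)[OF p_hom]
lemmas q_linear = hom_lie_homD(1)[OF q_hom]

lemma p_closed [simp]: "m \<in> carrier M \<Longrightarrow> p m \<in> carrier M'"
  by (rule linear_map_closed[OF p_linear])

lemma q_closed [simp]: "n \<in> carrier N \<Longrightarrow> q n \<in> carrier N'"
  by (rule linear_map_closed[OF q_linear])

lemma pairing: "hom_pairing R M N a b B.S (\<lambda>m n. B.s (p m) (q n))"
proof (rule hom_pairingI)
  show "bilinear_map R M N B.S (\<lambda>m n. B.s (p m) (q n))"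
    by (rule bilinear_map_comp[OF B.s_bilinear p_linear q_linear linear_map_id])
qed (simp_all add: hom_lie_homD(2,3)[OF p_hom] hom_lie_homD(2,3)[OF q_hom] p_b q_a B.s_relations)

text \<open>The linear map is kept separate from \<open>map_is_hom\<close>, since the projection to
  the product of the quotients is constructed before that product is known to have a
  bracket.\<close>

lemma exists_map:
  obtains f where "linear_map R A.S B.S f"
    "\<And>m n. \<lbrakk>m \<in> carrier M; n \<in> carrier N\<rbrakk> \<Longrightarrow> f (A.s m n) = B.s (p m) (q n)"
  using A.star_lift[OF B.star_is_module pairing] by metis

lemma map_is_hom:
  assumes "star_defined R M N a b" "star_defined R M' N' a' b'"
    and f: "linear_map R A.S B.S f"
    and f_s: "\<And>m n. \<lbrakk>m \<in> carrier M; n \<in> carrier N\<rbrakk> \<Longrightarrow> f (A.s m n) = B.s (p m) (q n)"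
  shows "f \<in> hom_lie_hom R A.S B.S"
proof -
  interpret A: hom_star R M N a b by unfold_locales fact
  interpret B: hom_star R M' N' a' b' by unfold_locales fact
  show ?thesis
  proof (rule hom_lie_homI[OF A.star_is_hom_lie B.star_is_hom_lie f])
    fix x y assume xy: "x \<in> carrier A.S" "y \<in> carrier A.S"
    show "f \<lblot>x, y\<rblot>\<^bsub>A.S\<^esub> = \<lblot>f x, f y\<rblot>\<^bsub>B.S\<^esub>"
    proof (rule A.star_ext2[OF B.star_is_module _ _ _ xy])
      show "bilinear_map R A.S A.S B.S (\<lambda>x y. f \<lblot>x, y\<rblot>\<^bsub>A.S\<^esub>)"
        by (rule bilinear_map_comp[OF A.bracket_bilinear linear_map_id linear_map_id f])
      show "bilinear_map R A.S A.S B.S (\<lambda>x y. \<lblot>f x, f y\<rblot>\<^bsub>B.S\<^esub>)"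
        by (rule bilinear_map_comp[OF B.bracket_bilinear f f linear_map_id])
    qed (simp add: A.bracket_s B.bracket_s f_s p_b q_a
        linear_map_neg[OF f A.star_is_module B.star_is_module])
  next
    fix x assume x: "x \<in> carrier A.S"
    show "f (twist A.S x) = twist B.S (f x)"
      by (rule A.star_ext[OF B.star_is_module linear_map_comp[OF A.twist_linear f]
            linear_map_comp[OF f B.twist_linear] _ x])
        (simp add: A.twist_s B.twist_s f_s hom_lie_homD(3)[OF p_hom] hom_lie_homD(3)[OF q_hom])
  qed
qed

end

section \<open>Hom-ideals and quotients\<close>

context
  fixes R K L
  assumes L: "hom_lie_algebra R L" and ideal: "hom_ideal R K L"
begin

interpretation L: hom_lie_algebra R L by (rule L)

lemma hom_ideal_submodule: "submodule (carrier K) R L"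
  using ideal unfolding hom_ideal_def by blast

lemma hom_ideal_mem: "x \<in> carrier K \<Longrightarrow> x \<in> carrier L"
  using hom_ideal_submodule L.submoduleE(1) by blast

lemma hom_ideal_ops:
  "\<zero>\<^bsub>K\<^esub> = \<zero>\<^bsub>L\<^esub>"
  "\<lbrakk>x \<in> carrier K; y \<in> carrier K\<rbrakk> \<Longrightarrow> x \<oplus>\<^bsub>K\<^esub> y = x \<oplus>\<^bsub>L\<^esub> y"
  "\<lbrakk>c \<in> carrier R; x \<in> carrier K\<rbrakk> \<Longrightarrow> c \<odot>\<^bsub>K\<^esub> x = c \<odot>\<^bsub>L\<^esub> x"
  "\<lbrakk>x \<in> carrier K; y \<in> carrier K\<rbrakk> \<Longrightarrow> \<lblot>x, y\<rblot>\<^bsub>K\<^esub> = \<lblot>x, y\<rblot>\<^bsub>L\<^esub>"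
  "x \<in> carrier K \<Longrightarrow> twist K x = twist L x"
  "\<lbrakk>x \<in> carrier K; y \<in> carrier L\<rbrakk> \<Longrightarrow> \<lblot>x, y\<rblot>\<^bsub>L\<^esub> \<in> carrier K"
  "x \<in> carrier K \<Longrightarrow> twist L x \<in> carrier K"
  using ideal by (simp_all add: hom_ideal_def)

lemma hom_ideal_is_module: "module R K"
  by (rule module_cong[OF submodule.submodule_is_module[OF hom_ideal_submodule L.module_axioms]])
    (simp_all add: hom_ideal_ops)

lemma hom_ideal_inclusion_linear: "linear_map R K L (\<lambda>x. x)"
  by (rule linear_mapI) (simp_all add: hom_ideal_mem hom_ideal_ops)

lemma hom_ideal_is_hom_lie: "hom_lie_algebra R K"
proof -
  interpret K: module R K by (rule hom_ideal_is_module)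
  note ops = hom_ideal_ops hom_ideal_mem
  \<comment> \<open>Negation in \<open>K\<close> is a description over the carrier of
    \<open>K\<close>; it is identified with negation in \<open>L\<close> through the linearity of
    the inclusion.\<close>
  note neg = linear_map_neg[OF hom_ideal_inclusion_linear hom_ideal_is_module L.module_axioms]
  have add: "x \<oplus>\<^bsub>L\<^esub> y \<in> carrier K" if "x \<in> carrier K" "y \<in> carrier K" for x y
    using K.a_closed[OF that] that by (simp add: ops)
  have smult: "c \<odot>\<^bsub>L\<^esub> x \<in> carrier K" if "c \<in> carrier R" "x \<in> carrier K" for c x
    using K.smult_closed[OF that] that by (simp add: ops)
  show ?thesis
  proof (intro hom_lie_algebra.intro hom_lie_algebra_axioms.intro hom_ideal_is_module L.field_axioms)
    show "bilinear_map R K K K (bracket K)"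
      by (intro bilinear_mapI linear_mapI)
        (simp_all add: ops add smult linear_map_add[OF bilinear_map_right[OF L.bracket_bilinear]]
          linear_map_add[OF bilinear_map_left[OF L.bracket_bilinear]]
          linear_map_smult[OF bilinear_map_right[OF L.bracket_bilinear]]
          linear_map_smult[OF bilinear_map_left[OF L.bracket_bilinear]])
    show "linear_map R K K (twist K)"
      by (intro linear_mapI)
        (simp_all add: ops add smult linear_map_add[OF L.twist_linear] linear_map_smult[OF L.twist_linear])
  next
    fix x y assume "x \<in> carrier K" "y \<in> carrier K"
    then show "\<lblot>x, y\<rblot>\<^bsub>K\<^esub> = \<ominus>\<^bsub>K\<^esub> \<lblot>y, x\<rblot>\<^bsub>K\<^esub>"
      using L.bracket_skew[of x y] neg[of "\<lblot>y, x\<rblot>\<^bsub>K\<^esub>"] by (simp add: ops)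
  next
    fix x y z assume "x \<in> carrier K" "y \<in> carrier K" "z \<in> carrier K"
    then show "\<lblot>twist K x, \<lblot>y, z\<rblot>\<^bsub>K\<^esub>\<rblot>\<^bsub>K\<^esub> \<oplus>\<^bsub>K\<^esub> \<lblot>twist K z, \<lblot>x, y\<rblot>\<^bsub>K\<^esub>\<rblot>\<^bsub>K\<^esub> \<oplus>\<^bsub>K\<^esub>
        \<lblot>twist K y, \<lblot>z, x\<rblot>\<^bsub>K\<^esub>\<rblot>\<^bsub>K\<^esub> = \<zero>\<^bsub>K\<^esub>"
      using L.hom_jacobi[of x y z] by (simp add: ops add)
  next
    fix x y assume "x \<in> carrier K" "y \<in> carrier K"
    then show "twist K \<lblot>x, y\<rblot>\<^bsub>K\<^esub> = \<lblot>twist K x, twist K y\<rblot>\<^bsub>K\<^esub>"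
      using L.twist_multiplicative[of x y] by (simp add: ops)
  qed
qed

lemma hom_ideal_inclusion: "(\<lambda>x. x) \<in> hom_lie_hom R K L"
  by (rule hom_lie_homI[OF hom_ideal_is_hom_lie L hom_ideal_inclusion_linear])
    (simp_all add: hom_ideal_ops)

end

lemma hom_lie_hom_id: "hom_lie_algebra R L \<Longrightarrow> (\<lambda>x. x) \<in> hom_lie_hom R L L"
  by (rule hom_lie_homI) (simp_all add: linear_map_id)

section \<open>Quotients of Hom-Lie algebras\<close>

lemma hom_lie_quotient_simps:
  "carrier (hom_lie_quotient L I) = carrier (quotient_module L I)"
  "\<zero>\<^bsub>hom_lie_quotient L I\<^esub> = \<zero>\<^bsub>quotient_module L I\<^esub>"
  "x \<oplus>\<^bsub>hom_lie_quotient L I\<^esub> y = x \<oplus>\<^bsub>quotient_module L I\<^esub> y"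
  "c \<odot>\<^bsub>hom_lie_quotient L I\<^esub> x = c \<odot>\<^bsub>quotient_module L I\<^esub> x"
  "bracket (hom_lie_quotient L I) = (\<lambda>X Y. \<Union>x\<in>X. \<Union>y\<in>Y. I +>\<^bsub>L\<^esub> \<lblot>x, y\<rblot>\<^bsub>L\<^esub>)"
  "twist (hom_lie_quotient L I) = (\<lambda>X. \<Union>x\<in>X. I +>\<^bsub>L\<^esub> twist L x)"
  unfolding hom_lie_quotient_def by (simp_all add: module.defs hom_lie.defs)

lemma linear_map_hom_lie_quotient:
  "linear_map R (hom_lie_quotient L I) U f \<longleftrightarrow> linear_map R (quotient_module L I) U f"
  "linear_map R V (hom_lie_quotient L I) g \<longleftrightarrow> linear_map R V (quotient_module L I) g"
  by (simp_all add: linear_map_def hom_lie_quotient_simps)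

text \<open>The ideal is a plain set here, so that the locale serves both the carrier of
  \<open>K\<close> and the sum of the two images, which is only formed as a set.\<close>

locale hom_lie_factor = hom_lie_algebra R L for R L +
  fixes I
  assumes ideal_submodule: "submodule I R L"
    and ideal_bracket: "\<lbrakk>x \<in> I; y \<in> carrier L\<rbrakk> \<Longrightarrow> \<lblot>x, y\<rblot>\<^bsub>L\<^esub> \<in> I"
    and ideal_twist: "x \<in> I \<Longrightarrow> twist L x \<in> I"
begin

abbreviation "Q \<equiv> hom_lie_quotient L I"
abbreviation "\<pi> x \<equiv> I +>\<^bsub>L\<^esub> x"

sublocale module_quotient R L I
  by (intro module_quotient.intro module_quotient_axioms.intro module_axioms ideal_submodule)

lemma hom_lie_quotient_is_module: "module R Q"
  by (rule module_cong[OF quotient_is_module]) (simp_all add: hom_lie_quotient_simps)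

lemma \<pi>_linear: "linear_map R L Q \<pi>"
  unfolding linear_map_hom_lie_quotient by (rule linear_coset)

lemma \<pi>_closed [simp]: "x \<in> carrier L \<Longrightarrow> \<pi> x \<in> carrier Q"
  by (rule linear_map_closed[OF \<pi>_linear])

lemma Q_cases:
  assumes "X \<in> carrier Q"
  obtains x where "x \<in> carrier L" "X = \<pi> x"
  using assms unfolding hom_lie_quotient_simps quotient_module_simps by (rule coset_cases)

lemma \<pi>_eq_zero_iff: "x \<in> carrier L \<Longrightarrow> \<pi> x = \<zero>\<^bsub>Q\<^esub> \<longleftrightarrow> x \<in> I"
  unfolding hom_lie_quotient_simps quotient_module_simps by (rule coset_eq_zero_iff)

lemma Q_lift:
  assumes "module R U" "linear_map R L U f" "\<And>x. x \<in> I \<Longrightarrow> f x = \<zero>\<^bsub>U\<^esub>"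
  obtains g where "linear_map R Q U g" "\<And>x. x \<in> carrier L \<Longrightarrow> g (\<pi> x) = f x"
  using quotient_lift[OF assms] unfolding linear_map_hom_lie_quotient by metis

lemma ideal_bracket_right:
  assumes "x \<in> carrier L" "y \<in> I"
  shows "\<lblot>x, y\<rblot>\<^bsub>L\<^esub> \<in> I"
proof -
  have "\<ominus>\<^bsub>L\<^esub> \<lblot>y, x\<rblot>\<^bsub>L\<^esub> \<in> I" using assms ideal_bracket by simp
  then show ?thesis using bracket_skew[of x y] assms by simp
qed

lemma Q_bracket:
  assumes "x \<in> carrier L" "y \<in> carrier L"
  shows "\<lblot>\<pi> x, \<pi> y\<rblot>\<^bsub>Q\<^esub> = \<pi> \<lblot>x, y\<rblot>\<^bsub>L\<^esub>"
proof -
  \<comment> \<open>The representatives are changed one at a time; each change alters the bracket by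
    a bracket with an element of \<open>I\<close>.\<close>
  have *: "\<pi> \<lblot>x', y'\<rblot>\<^bsub>L\<^esub> = \<pi> \<lblot>x, y\<rblot>\<^bsub>L\<^esub>"
    if "x \<in> carrier L" "y \<in> carrier L" "x' \<in> carrier L" "y' \<in> carrier L" "\<pi> x' = \<pi> x" "\<pi> y' = \<pi> y"
    for x y x' y'
  proof -
    have "\<lblot>x' \<ominus>\<^bsub>L\<^esub> x, y'\<rblot>\<^bsub>L\<^esub> \<in> I" "\<lblot>x, y' \<ominus>\<^bsub>L\<^esub> y\<rblot>\<^bsub>L\<^esub> \<in> I"
      using that coset_eq_iff ideal_bracket ideal_bracket_right by blast+
    then have "\<pi> \<lblot>x', y'\<rblot>\<^bsub>L\<^esub> = \<pi> \<lblot>x, y'\<rblot>\<^bsub>L\<^esub>" "\<pi> \<lblot>x, y'\<rblot>\<^bsub>L\<^esub> = \<pi> \<lblot>x, y\<rblot>\<^bsub>L\<^esub>"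
      using that by (simp_all add: coset_eq_iff
          linear_map_minus[OF bilinear_map_left[OF bracket_bilinear] module_axioms module_axioms]
          linear_map_minus[OF bilinear_map_right[OF bracket_bilinear] module_axioms module_axioms])
    then show ?thesis by simp
  qed
  \<comment> \<open>The nested unions are collapsed from the inside out, so the inner one is
    evaluated for an arbitrary outer representative.\<close>
  have inner: "(\<Union>y'\<in>\<pi> y. \<pi> \<lblot>x', y'\<rblot>\<^bsub>L\<^esub>) = \<pi> \<lblot>x', y\<rblot>\<^bsub>L\<^esub>" if "x' \<in> carrier L" for x'
    using assms that by (intro Union_coset *) simp_all
  have "(\<Union>x'\<in>\<pi> x. \<Union>y'\<in>\<pi> y. \<pi> \<lblot>x', y'\<rblot>\<^bsub>L\<^esub>) = (\<Union>y'\<in>\<pi> y. \<pi> \<lblot>x, y'\<rblot>\<^bsub>L\<^esub>)"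
  proof (rule Union_coset[OF assms(1)])
    fix z assume "z \<in> carrier L" "\<pi> z = \<pi> x"
    then show "(\<Union>y'\<in>\<pi> y. \<pi> \<lblot>z, y'\<rblot>\<^bsub>L\<^esub>) = (\<Union>y'\<in>\<pi> y. \<pi> \<lblot>x, y'\<rblot>\<^bsub>L\<^esub>)"
      using *[OF assms, of z y] assms by (simp add: inner)
  qed
  then show ?thesis
    unfolding hom_lie_quotient_simps by (simp add: inner assms)
qed

lemma Q_twist:
  assumes "x \<in> carrier L"
  shows "twist Q (\<pi> x) = \<pi> (twist L x)"
  unfolding hom_lie_quotient_simps
proof (rule Union_coset[OF assms])
  fix y assume y: "y \<in> carrier L" "\<pi> y = \<pi> x"
  then have "twist L (y \<ominus>\<^bsub>L\<^esub> x) \<in> I" using assms coset_eq_iff ideal_twist by blast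
  then show "\<pi> (twist L y) = \<pi> (twist L x)"
    using assms y by (simp add: coset_eq_iff linear_map_minus[OF twist_linear module_axioms module_axioms])
qed

lemma Q_hom_lie: "hom_lie_algebra R Q"
proof -
  note ring = linear_map_add[OF \<pi>_linear, symmetric] linear_map_smult[OF \<pi>_linear, symmetric]
    linear_map_neg[OF \<pi>_linear module_axioms hom_lie_quotient_is_module, symmetric]
  show ?thesis
  proof (intro hom_lie_algebra.intro hom_lie_algebra_axioms.intro hom_lie_quotient_is_module field_axioms)
    show "bilinear_map R Q Q Q (bracket Q)"
      by (intro bilinear_mapI linear_mapI)
        (auto elim!: Q_cases simp: ring Q_bracket linear_map_add[OF bilinear_map_right[OF bracket_bilinear]]
          linear_map_add[OF bilinear_map_left[OF bracket_bilinear]]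
          linear_map_smult[OF bilinear_map_right[OF bracket_bilinear]]
          linear_map_smult[OF bilinear_map_left[OF bracket_bilinear]])
    show "linear_map R Q Q (twist Q)"
      by (intro linear_mapI)
        (auto elim!: Q_cases simp: ring Q_twist linear_map_add[OF twist_linear] linear_map_smult[OF twist_linear])
  next
    fix X Y assume "X \<in> carrier Q" "Y \<in> carrier Q"
    then obtain x y where "x \<in> carrier L" "X = \<pi> x" "y \<in> carrier L" "Y = \<pi> y"
      by (metis Q_cases)
    then show "\<lblot>X, Y\<rblot>\<^bsub>Q\<^esub> = \<ominus>\<^bsub>Q\<^esub> \<lblot>Y, X\<rblot>\<^bsub>Q\<^esub>"
      using bracket_skew[of x y] by (simp add: ring Q_bracket)
  next
    fix X Y Z assume "X \<in> carrier Q" "Y \<in> carrier Q" "Z \<in> carrier Q"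
    then show "\<lblot>twist Q X, \<lblot>Y, Z\<rblot>\<^bsub>Q\<^esub>\<rblot>\<^bsub>Q\<^esub> \<oplus>\<^bsub>Q\<^esub> \<lblot>twist Q Z, \<lblot>X, Y\<rblot>\<^bsub>Q\<^esub>\<rblot>\<^bsub>Q\<^esub> \<oplus>\<^bsub>Q\<^esub>
        \<lblot>twist Q Y, \<lblot>Z, X\<rblot>\<^bsub>Q\<^esub>\<rblot>\<^bsub>Q\<^esub> = \<zero>\<^bsub>Q\<^esub>"
      by (auto elim!: Q_cases simp: ring Q_bracket Q_twist hom_jacobi
          linear_map_zero[OF \<pi>_linear module_axioms hom_lie_quotient_is_module])
  next
    fix X Y assume "X \<in> carrier Q" "Y \<in> carrier Q"
    then show "twist Q \<lblot>X, Y\<rblot>\<^bsub>Q\<^esub> = \<lblot>twist Q X, twist Q Y\<rblot>\<^bsub>Q\<^esub>"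
      by (auto elim!: Q_cases simp: Q_bracket Q_twist twist_multiplicative)
  qed
qed

lemma \<pi>_hom: "\<pi> \<in> hom_lie_hom R L Q"
  by (rule hom_lie_homI[OF hom_lie_algebra_axioms Q_hom_lie \<pi>_linear]) (simp_all add: Q_bracket Q_twist)

end

lemma hom_ideal_factor:
  assumes "hom_lie_algebra R L" "hom_ideal R K L"
  shows "hom_lie_factor R L (carrier K)"
  using assms unfolding hom_lie_factor_def hom_lie_factor_axioms_def hom_ideal_def by blast

lemma hom_ideal_sum_factor:
  assumes L: "hom_lie_algebra R L"
    and U: "hom_ideal R (L\<lparr>carrier := U\<rparr>) L" and W: "hom_ideal R (L\<lparr>carrier := W\<rparr>) L"
  shows "hom_lie_factor R L (U <+>\<^bsub>L\<^esub> W)"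
proof -
  interpret L: hom_lie_algebra R L by fact
  note U' = hom_ideal_mem[OF L U, simplified] hom_ideal_ops(6,7)[OF L U, simplified]
  note W' = hom_ideal_mem[OF L W, simplified] hom_ideal_ops(6,7)[OF L W, simplified]
  have mem: "u \<oplus>\<^bsub>L\<^esub> w \<in> U <+>\<^bsub>L\<^esub> W" if "u \<in> U" "w \<in> W" for u w
    using that unfolding set_add_def' by blast
  have cases: "\<exists>u\<in>U. \<exists>w\<in>W. x = u \<oplus>\<^bsub>L\<^esub> w" if "x \<in> U <+>\<^bsub>L\<^esub> W" for x
    using that unfolding set_add_def' by blast
  show ?thesis
  proof (intro hom_lie_factor.intro hom_lie_factor_axioms.intro L)
    show "submodule (U <+>\<^bsub>L\<^esub> W) R L"
      using hom_ideal_submodule[OF L U] hom_ideal_submodule[OF L W]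
      by (intro L.submodule_set_add) simp_all
  next
    fix x y assume "x \<in> U <+>\<^bsub>L\<^esub> W" and y: "y \<in> carrier L"
    then obtain u w where x: "u \<in> U" "w \<in> W" "x = u \<oplus>\<^bsub>L\<^esub> w" using cases by blast
    then have "\<lblot>x, y\<rblot>\<^bsub>L\<^esub> = \<lblot>u, y\<rblot>\<^bsub>L\<^esub> \<oplus>\<^bsub>L\<^esub> \<lblot>w, y\<rblot>\<^bsub>L\<^esub>"
      using y U'(1) W'(1) linear_map_add[OF bilinear_map_left[OF L.bracket_bilinear y]] by simp
    then show "\<lblot>x, y\<rblot>\<^bsub>L\<^esub> \<in> U <+>\<^bsub>L\<^esub> W"
      using mem x y U'(2) W'(2) by simp
  next
    fix x assume "x \<in> U <+>\<^bsub>L\<^esub> W"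
    then obtain u w where x: "u \<in> U" "w \<in> W" "x = u \<oplus>\<^bsub>L\<^esub> w" using cases by blast
    then have "twist L x = twist L u \<oplus>\<^bsub>L\<^esub> twist L w"
      using U'(1) W'(1) linear_map_add[OF L.twist_linear] by simp
    then show "twist L x \<in> U <+>\<^bsub>L\<^esub> W"
      using mem x U'(3) W'(3) by simp
  qed
qed

section \<open>The tensor product of two quotients\<close>

text \<open>Closure under the bracket is required only on generators of \<open>X\<close> and of the
  star product. It spreads by linearity, first in the element of \<open>X\<close> and then in the
  second argument.\<close>

lemma (in hom_star) image_is_hom_ideal:
  assumes X: "module R X" and i: "linear_map R X S i"
    and gen: "carrier X \<subseteq> subspace_span R X B" "B \<subseteq> carrier X"
    and twist_i: "\<And>x. x \<in> carrier X \<Longrightarrow> twist S (i x) \<in> i ` carrier X"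
    and bracket_i: "\<And>x m n. \<lbrakk>x \<in> B; m \<in> carrier M; n \<in> carrier N\<rbrakk> \<Longrightarrow>
      \<lblot>i x, s m n\<rblot>\<^bsub>S\<^esub> \<in> i ` carrier X"
  shows "hom_ideal R (S\<lparr>carrier := i ` carrier X\<rparr>) S"
proof -
  let ?I = "i ` carrier X"
  have I: "submodule ?I R S"
    by (rule submodule_image[OF X star_is_module i])
  have *: "\<lblot>i x, s m n\<rblot>\<^bsub>S\<^esub> \<in> ?I" if "x \<in> carrier X" "m \<in> carrier M" "n \<in> carrier N" for x m n
  proof -
    have "submodule {x \<in> carrier X. \<lblot>i x, s m n\<rblot>\<^bsub>S\<^esub> \<in> ?I} R X"
      by (rule submodule_vimage[OF X star_is_module
            linear_map_comp[OF i bilinear_map_left[OF bracket_bilinear]] I]) (use that in simp)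
    from subspace_span_minimal[OF this, of B] show ?thesis
      using gen bracket_i that by blast
  qed
  have "\<lblot>i x, y\<rblot>\<^bsub>S\<^esub> \<in> ?I" if "x \<in> carrier X" "y \<in> carrier S" for x y
  proof -
    have "submodule {y \<in> carrier S. \<lblot>i x, y\<rblot>\<^bsub>S\<^esub> \<in> ?I} R S"
      by (rule submodule_vimage[OF star_is_module star_is_module
            bilinear_map_right[OF bracket_bilinear linear_map_closed[OF i that(1)]] I])
    from star_subset_submodule[OF this] show ?thesis
      using * that by fastforce
  qed
  then show ?thesis
    unfolding hom_ideal_def using I twist_i by auto
qed

lemma star_inclusionD:
  assumes "star_inclusion R M N M' N' a b i"
  shows "i \<in> hom_lie_hom R (star R M N a b) (star R M' N' a b)"
    and "\<lbrakk>m \<in> carrier M; n \<in> carrier N\<rbrakk> \<Longrightarrow> i (star_elem R M N a b m n) = star_elem R M' N' a b m n"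
  using assms unfolding star_inclusion_def by simp_all

text \<open>The product of the quotients enters only as a pair of actions: the existence of its
  bracket is still to be proved.\<close>

locale star_of_quotients =
  GH: hom_star R G H a b + KH: hom_star R K H a b + GK: hom_star R G K a b +
  Q: hom_action_pair R "hom_lie_quotient G (carrier K)" "hom_lie_quotient H (carrier K)"
    "quotient_action H (carrier K) a" "quotient_action G (carrier K) b"
  for R :: "('k, 'r) ring_scheme" and G H K :: "('k, 'a) hom_lie" and a b :: "'a \<Rightarrow> 'a \<Rightarrow> 'a" +
  assumes ideal_G: "hom_ideal R K G" and ideal_H: "hom_ideal R K H"
begin

abbreviation "aK \<equiv> quotient_action H (carrier K) a"
abbreviation "bK \<equiv> quotient_action G (carrier K) b"

interpretation G: hom_lie_factor R G "carrier K"
  by (rule hom_ideal_factor[OF GH.M.hom_lie_algebra_axioms ideal_G])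

interpretation H: hom_lie_factor R H "carrier K"
  by (rule hom_ideal_factor[OF GH.N.hom_lie_algebra_axioms ideal_H])

lemma K_mem [simp]: "k \<in> carrier K \<Longrightarrow> k \<in> carrier G" "k \<in> carrier K \<Longrightarrow> k \<in> carrier H"
  by (rule hom_ideal_mem[OF GH.M.hom_lie_algebra_axioms ideal_G], assumption)
    (rule hom_ideal_mem[OF GH.N.hom_lie_algebra_axioms ideal_H])

text \<open>An induced Hom-action takes values in the quotient by bilinearity, and
  \<open>Union_cosets_closed\<close> derives from this that the union is the coset of
  \<open>a g h\<close>.\<close>

lemma aK_coset:
  assumes "g \<in> carrier G" "h \<in> carrier H"
  shows "aK (G.\<pi> g) (H.\<pi> h) = H.\<pi> (a g h)"
proof -
  have "aK (G.\<pi> g) (H.\<pi> h) \<in> carrier H.Q" using assms by simp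
  then show ?thesis
    unfolding quotient_action_def hom_lie_quotient_simps quotient_module_simps
    by (intro H.Union_cosets_closed G.a_rcos_self H.a_rcos_self) (use assms in simp_all)
qed

lemma bK_coset:
  assumes "g \<in> carrier G" "h \<in> carrier H"
  shows "bK (H.\<pi> h) (G.\<pi> g) = G.\<pi> (b h g)"
proof -
  have "bK (H.\<pi> h) (G.\<pi> g) \<in> carrier G.Q" using assms by simp
  then show ?thesis
    unfolding quotient_action_def hom_lie_quotient_simps quotient_module_simps
    by (intro G.Union_cosets_closed G.a_rcos_self H.a_rcos_self) (use assms in simp_all)
qed

text \<open>Three instances of functoriality follow: the two inclusions of \<open>K\<close> in one
  factor, and the projections to cosets in both.\<close>

interpretation KH_GH: star_map R K H a b G H a b "\<lambda>x. x" "\<lambda>x. x"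
  by unfold_locales
    (simp_all add: hom_ideal_inclusion[OF GH.M.hom_lie_algebra_axioms ideal_G]
      hom_lie_hom_id GH.N.hom_lie_algebra_axioms)

interpretation GK_GH: star_map R G K a b G H a b "\<lambda>x. x" "\<lambda>x. x"
  by unfold_locales
    (simp_all add: hom_ideal_inclusion[OF GH.N.hom_lie_algebra_axioms ideal_H]
      hom_lie_hom_id GH.M.hom_lie_algebra_axioms)

interpretation GH_Q: star_map R G H a b G.Q H.Q aK bK G.\<pi> H.\<pi>
  by unfold_locales (simp_all add: G.\<pi>_hom H.\<pi>_hom aK_coset bK_coset)

lemma inclusion_KH: "\<exists>i. star_inclusion R K H G H a b i"
  using KH_GH.exists_map KH_GH.map_is_hom[OF KH.defined GH.defined]
  unfolding star_inclusion_def by metis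

lemma inclusion_GK: "\<exists>i. star_inclusion R G K G H a b i"
  using GK_GH.exists_map GK_GH.map_is_hom[OF GK.defined GH.defined]
  unfolding star_inclusion_def by metis

text \<open>Vanishing when either argument lies in \<open>K\<close> makes \<open>F\<close> constant
  on cosets in each variable. The relations then hold for cosets because brackets, twists and
  actions of the quotients are computed on representatives.\<close>

lemma pairing_descends:
  assumes W: "module R W" and F: "hom_pairing R G H a b W F"
    and F_left: "\<And>k h. \<lbrakk>k \<in> carrier K; h \<in> carrier H\<rbrakk> \<Longrightarrow> F k h = \<zero>\<^bsub>W\<^esub>"
    and F_right: "\<And>g k. \<lbrakk>g \<in> carrier G; k \<in> carrier K\<rbrakk> \<Longrightarrow> F g k = \<zero>\<^bsub>W\<^esub>"
  obtains f where "hom_pairing R G.Q H.Q aK bK W f"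
    "\<And>g h. \<lbrakk>g \<in> carrier G; h \<in> carrier H\<rbrakk> \<Longrightarrow> f (G.\<pi> g) (H.\<pi> h) = F g h"
proof
  interpret W: module R W by fact
  note F_bi = hom_pairingD(1)[OF F]
  note F_closed = bilinear_map_closed[OF F_bi]
  have F_cong: "F g h = F g' h'"
    if gh: "g \<in> carrier G" "h \<in> carrier H" "g' \<in> carrier G" "h' \<in> carrier H"
      and eq: "G.\<pi> g = G.\<pi> g'" "H.\<pi> h = H.\<pi> h'" for g h g' h'
  proof -
    have "g \<ominus>\<^bsub>G\<^esub> g' \<in> carrier K" "h \<ominus>\<^bsub>H\<^esub> h' \<in> carrier K"
      using eq G.coset_eq_iff[OF gh(1,3)] H.coset_eq_iff[OF gh(2,4)] by simp_all
    then have "F (g \<ominus>\<^bsub>G\<^esub> g') h = \<zero>\<^bsub>W\<^esub>" "F g' (h \<ominus>\<^bsub>H\<^esub> h') = \<zero>\<^bsub>W\<^esub>"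
      using F_left F_right gh by simp_all
    then have "F g h = F g' h" "F g' h = F g' h'"
      using gh linear_map_minus[OF bilinear_map_left[OF F_bi] GH.M.module_axioms W]
        linear_map_minus[OF bilinear_map_right[OF F_bi] GH.N.module_axioms W]
      by (simp_all add: W.M.minus_eq_zero_iff F_closed)
    then show ?thesis by simp
  qed
  define f where "f X Y = F (SOME g. g \<in> carrier G \<and> G.\<pi> g = X) (SOME h. h \<in> carrier H \<and> H.\<pi> h = Y)"
    for X Y
  show f: "f (G.\<pi> g) (H.\<pi> h) = F g h" if gh: "g \<in> carrier G" "h \<in> carrier H" for g h
  proof -
    define g' where "g' = (SOME g'. g' \<in> carrier G \<and> G.\<pi> g' = G.\<pi> g)"
    define h' where "h' = (SOME h'. h' \<in> carrier H \<and> H.\<pi> h' = H.\<pi> h)"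
    have "g' \<in> carrier G \<and> G.\<pi> g' = G.\<pi> g" unfolding g'_def by (rule someI) (use gh in simp)
    moreover have "h' \<in> carrier H \<and> H.\<pi> h' = H.\<pi> h" unfolding h'_def by (rule someI) (use gh in simp)
    ultimately have "F g' h' = F g h" using F_cong gh by blast
    then show ?thesis unfolding f_def g'_def h'_def .
  qed
  note ring = linear_map_add[OF G.\<pi>_linear, symmetric] linear_map_smult[OF G.\<pi>_linear, symmetric]
    linear_map_add[OF H.\<pi>_linear, symmetric] linear_map_smult[OF H.\<pi>_linear, symmetric]
  note vals = f aK_coset bK_coset G.Q_bracket H.Q_bracket G.Q_twist H.Q_twist
  show "hom_pairing R G.Q H.Q aK bK W f"
  proof (rule hom_pairingI)
    show "bilinear_map R G.Q H.Q W f"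
      by (intro bilinear_mapI linear_mapI)
        (auto elim!: G.Q_cases H.Q_cases simp: ring f F_closed
          linear_map_add[OF bilinear_map_left[OF F_bi]] linear_map_smult[OF bilinear_map_left[OF F_bi]]
          linear_map_add[OF bilinear_map_right[OF F_bi]] linear_map_smult[OF bilinear_map_right[OF F_bi]])
  qed (elim G.Q_cases H.Q_cases, simp add: vals hom_pairingD(2-)[OF F])+
qed

text \<open>The bracket of \<open>k\<close> tensor \<open>h'\<close> with \<open>g\<close> tensor
  \<open>h\<close> has left factor \<open>b h' k\<close> up to sign, and this lies in
  \<open>K\<close> because \<open>H\<close> acts on \<open>K\<close>.\<close>

lemma image_KH_ideal:
  assumes i: "star_inclusion R K H G H a b i"
  shows "hom_ideal R (GH.S\<lparr>carrier := i ` carrier KH.S\<rparr>) GH.S"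
proof (rule GH.image_is_hom_ideal[OF KH.star_is_module _ KH.star_generated])
  show lin: "linear_map R KH.S GH.S i"
    by (rule hom_lie_homD(1)[OF star_inclusionD(1)[OF i]])
  show "twist GH.S (i x) \<in> i ` carrier KH.S" if "x \<in> carrier KH.S" for x
    using hom_lie_homD(3)[OF star_inclusionD(1)[OF i] that] KH.star_twist_closed[OF that]
    by (metis imageI)
  fix x g h assume "x \<in> {KH.s k h' | k h'. k \<in> carrier K \<and> h' \<in> carrier H}"
    and gh: "g \<in> carrier G" "h \<in> carrier H"
  then obtain k h' where x: "k \<in> carrier K" "h' \<in> carrier H" "x = KH.s k h'" by blast
  have "\<lblot>i x, GH.s g h\<rblot>\<^bsub>GH.S\<^esub> = i (\<ominus>\<^bsub>KH.S\<^esub> KH.s (b h' k) (a g h))"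
    using x gh by (simp add: star_inclusionD(2)[OF i] GH.bracket_s
        linear_map_neg[OF lin KH.star_is_module GH.star_is_module])
  then show "\<lblot>i x, GH.s g h\<rblot>\<^bsub>GH.S\<^esub> \<in> i ` carrier KH.S"
    using x gh by simp
qed auto

text \<open>Here skew-symmetry is applied first, since the right factor of a bracket comes from its
  second argument. After the swap that factor is \<open>a g' k\<close>, which lies in
  \<open>K\<close> because \<open>G\<close> acts on \<open>K\<close>.\<close>

lemma image_GK_ideal:
  assumes i: "star_inclusion R G K G H a b i"
  shows "hom_ideal R (GH.S\<lparr>carrier := i ` carrier GK.S\<rparr>) GH.S"
proof (rule GH.image_is_hom_ideal[OF GK.star_is_module _ GK.star_generated])
  show lin: "linear_map R GK.S GH.S i"
    by (rule hom_lie_homD(1)[OF star_inclusionD(1)[OF i]])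
  show "twist GH.S (i x) \<in> i ` carrier GK.S" if "x \<in> carrier GK.S" for x
    using hom_lie_homD(3)[OF star_inclusionD(1)[OF i] that] GK.star_twist_closed[OF that]
    by (metis imageI)
  fix x g h assume "x \<in> {GK.s g' k | g' k. g' \<in> carrier G \<and> k \<in> carrier K}"
    and gh: "g \<in> carrier G" "h \<in> carrier H"
  then obtain g' k where x: "g' \<in> carrier G" "k \<in> carrier K" "x = GK.s g' k" by blast
  have "\<lblot>i x, GH.s g h\<rblot>\<^bsub>GH.S\<^esub> = \<ominus>\<^bsub>GH.S\<^esub> \<lblot>GH.s g h, GH.s g' k\<rblot>\<^bsub>GH.S\<^esub>"
    using x gh by (simp add: star_inclusionD(2)[OF i] GH.star_bracket_skew[of "GH.s g' k"])
  also have "\<dots> = i (GK.s (b h g) (a g' k))"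
    using x gh by (simp add: star_inclusionD(2)[OF i] GH.bracket_s)
  finally show "\<lblot>i x, GH.s g h\<rblot>\<^bsub>GH.S\<^esub> \<in> i ` carrier GK.S"
    using x gh by simp
qed auto

lemma quotient_iso:
  assumes i1: "star_inclusion R K H G H a b i\<^sub>1" and i2: "star_inclusion R G K G H a b i\<^sub>2"
  defines "I \<equiv> i\<^sub>1 ` carrier KH.S <+>\<^bsub>GH.S\<^esub> i\<^sub>2 ` carrier GK.S"
  shows "\<exists>\<phi> \<in> hom_lie_iso R Q.S (hom_lie_quotient GH.S I).
    \<forall>g\<in>carrier G. \<forall>h\<in>carrier H. \<phi> (Q.s (G.\<pi> g) (H.\<pi> h)) = I +>\<^bsub>GH.S\<^esub> GH.s g h"
proof -
  interpret I: hom_lie_factor R GH.S I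
    unfolding I_def
    by (rule hom_ideal_sum_factor[OF GH.star_is_hom_lie image_KH_ideal[OF i1] image_GK_ideal[OF i2]])
  note i1_lin = hom_lie_homD(1)[OF star_inclusionD(1)[OF i1]]
  note i2_lin = hom_lie_homD(1)[OF star_inclusionD(1)[OF i2]]
  have I_cases: "\<exists>x\<in>carrier KH.S. \<exists>y\<in>carrier GK.S. z = i\<^sub>1 x \<oplus>\<^bsub>GH.S\<^esub> i\<^sub>2 y" if "z \<in> I" for z
    using that unfolding I_def set_add_def' by blast
  have I_mem: "i\<^sub>1 x \<oplus>\<^bsub>GH.S\<^esub> i\<^sub>2 y \<in> I" if "x \<in> carrier KH.S" "y \<in> carrier GK.S" for x y
    using that unfolding I_def set_add_def' by blast
  \<comment> \<open>Membership in the sum is shown with zero as the other summand.\<close>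
  have s_KH: "GH.s k h \<in> I" if "k \<in> carrier K" "h \<in> carrier H" for k h
    using I_mem[of "KH.s k h" "\<zero>\<^bsub>GK.S\<^esub>"] that linear_map_zero[OF i2_lin GK.star_is_module GH.star_is_module]
    by (simp add: star_inclusionD(2)[OF i1])
  have s_GK: "GH.s g k \<in> I" if "g \<in> carrier G" "k \<in> carrier K" for g k
    using I_mem[of "\<zero>\<^bsub>KH.S\<^esub>" "GK.s g k"] that linear_map_zero[OF i1_lin KH.star_is_module GH.star_is_module]
    by (simp add: star_inclusionD(2)[OF i2])

  obtain \<rho> where \<rho>: "linear_map R GH.S Q.S \<rho>"
    and \<rho>_s: "\<And>g h. \<lbrakk>g \<in> carrier G; h \<in> carrier H\<rbrakk> \<Longrightarrow> \<rho> (GH.s g h) = Q.s (G.\<pi> g) (H.\<pi> h)"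
    using GH_Q.exists_map by metis
  have \<rho>_i1: "\<rho> (i\<^sub>1 x) = \<zero>\<^bsub>Q.S\<^esub>" if x: "x \<in> carrier KH.S" for x
  proof (rule KH.star_ext[OF Q.star_is_module linear_map_comp[OF i1_lin \<rho>]
        linear_map_const_zero[OF Q.star_is_module] _ x])
    fix k h assume kh: "k \<in> carrier K" "h \<in> carrier H"
    then have "G.\<pi> k = \<zero>\<^bsub>G.Q\<^esub>" by (simp add: G.\<pi>_eq_zero_iff)
    then show "\<rho> (i\<^sub>1 (KH.s k h)) = \<zero>\<^bsub>Q.S\<^esub>"
      using kh linear_map_zero[OF bilinear_map_left[OF Q.s_bilinear] G.hom_lie_quotient_is_module Q.star_is_module]
      by (simp add: star_inclusionD(2)[OF i1] \<rho>_s)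
  qed
  have \<rho>_i2: "\<rho> (i\<^sub>2 x) = \<zero>\<^bsub>Q.S\<^esub>" if x: "x \<in> carrier GK.S" for x
  proof (rule GK.star_ext[OF Q.star_is_module linear_map_comp[OF i2_lin \<rho>]
        linear_map_const_zero[OF Q.star_is_module] _ x])
    fix g k assume gk: "g \<in> carrier G" "k \<in> carrier K"
    then have "H.\<pi> k = \<zero>\<^bsub>H.Q\<^esub>" by (simp add: H.\<pi>_eq_zero_iff)
    then show "\<rho> (i\<^sub>2 (GK.s g k)) = \<zero>\<^bsub>Q.S\<^esub>"
      using gk linear_map_zero[OF bilinear_map_right[OF Q.s_bilinear] H.hom_lie_quotient_is_module Q.star_is_module]
      by (simp add: star_inclusionD(2)[OF i2] \<rho>_s)
  qed
  have "\<rho> z = \<zero>\<^bsub>Q.S\<^esub>" if z: "z \<in> I" for z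
  proof -
    obtain x y where "x \<in> carrier KH.S" "y \<in> carrier GK.S" "z = i\<^sub>1 x \<oplus>\<^bsub>GH.S\<^esub> i\<^sub>2 y"
      using I_cases[OF z] by blast
    then show ?thesis
      using linear_map_closed[OF i1_lin] linear_map_closed[OF i2_lin]
      by (simp add: linear_map_add[OF \<rho>] \<rho>_i1 \<rho>_i2)
  qed
  then obtain \<psi> where \<psi>: "linear_map R I.Q Q.S \<psi>"
    and \<psi>_\<pi>: "\<And>x. x \<in> carrier GH.S \<Longrightarrow> \<psi> (I.\<pi> x) = \<rho> x"
    using I.Q_lift[OF Q.star_is_module \<rho>] by metis

  note I_mod = I.hom_lie_quotient_is_module
  have "hom_pairing R G H a b I.Q (\<lambda>g h. I.\<pi> (GH.s g h))"
    by (rule hom_pairing_comp[OF GH.star_elem_pairing GH.star_is_module I_mod I.\<pi>_linear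
          GH.hom_action_pair_axioms])
  then obtain f where f: "hom_pairing R G.Q H.Q aK bK I.Q f"
    and f_\<pi>: "\<And>g h. \<lbrakk>g \<in> carrier G; h \<in> carrier H\<rbrakk> \<Longrightarrow> f (G.\<pi> g) (H.\<pi> h) = I.\<pi> (GH.s g h)"
    using pairing_descends[OF I_mod] I.\<pi>_eq_zero_iff s_KH s_GK GH.s_closed K_mem by (metis (no_types, lifting))
  then obtain \<phi> where \<phi>: "linear_map R Q.S I.Q \<phi>"
    and \<phi>_s': "\<And>X Y. \<lbrakk>X \<in> carrier G.Q; Y \<in> carrier H.Q\<rbrakk> \<Longrightarrow> \<phi> (Q.s X Y) = f X Y"
    using Q.star_lift[OF I_mod f] by metis
  have \<phi>_s: "\<phi> (Q.s (G.\<pi> g) (H.\<pi> h)) = I.\<pi> (GH.s g h)" if "g \<in> carrier G" "h \<in> carrier H" for g h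
    using that by (simp add: \<phi>_s' f_\<pi>)

  \<comment> \<open>Comparison on generators before passing to cosets; as \<open>\<psi>\<close> is
    induced by \<open>\<rho>\<close>, this shows that \<open>\<phi>\<close> is a left inverse of
    \<open>\<psi>\<close>.\<close>
  have "\<phi> (\<rho> x) = I.\<pi> x" if "x \<in> carrier GH.S" for x
    by (rule GH.star_ext[OF I_mod linear_map_comp[OF \<rho> \<phi>] I.\<pi>_linear _ that]) (simp add: \<rho>_s \<phi>_s)
  then have \<phi>_\<psi>: "\<phi> (\<psi> X) = X" if "X \<in> carrier I.Q" for X
    using that by (auto elim!: I.Q_cases simp: \<psi>_\<pi>)
  have \<psi>_\<phi>: "\<psi> (\<phi> x) = x" if "x \<in> carrier Q.S" for x
    by (rule Q.star_ext[OF Q.star_is_module linear_map_comp[OF \<phi> \<psi>] linear_map_id _ that])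
      (auto elim!: G.Q_cases H.Q_cases simp: \<phi>_s \<psi>_\<pi> \<rho>_s)

  note I_neg = linear_map_neg[OF I.\<pi>_linear GH.star_is_module I_mod]
  \<comment> \<open>Serves twice: it shows that the transported bracket has the values prescribed on
    generators, and later that \<open>\<phi>\<close> preserves the bracket that \<open>star\<close>
    selects.\<close>
  have bracket_\<phi>: "\<lblot>\<phi> (Q.s X Y), \<phi> (Q.s X' Y')\<rblot>\<^bsub>I.Q\<^esub> = \<phi> (\<ominus>\<^bsub>Q.S\<^esub> Q.s (bK Y X) (aK X' Y'))"
    if XY: "X \<in> carrier G.Q" "X' \<in> carrier G.Q" "Y \<in> carrier H.Q" "Y' \<in> carrier H.Q" for X X' Y Y'
  proof -
    obtain g g' h h' where "g \<in> carrier G" "X = G.\<pi> g" "g' \<in> carrier G" "X' = G.\<pi> g'"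
      "h \<in> carrier H" "Y = H.\<pi> h" "h' \<in> carrier H" "Y' = H.\<pi> h'"
      using XY by (metis G.Q_cases H.Q_cases)
    then show ?thesis
      by (simp add: linear_map_neg[OF \<phi> Q.star_is_module I_mod] \<phi>_s I.Q_bracket GH.bracket_s I_neg
          aK_coset bK_coset)
  qed
  have "bilinear_map R Q.S Q.S Q.S (\<lambda>x y. \<psi> \<lblot>\<phi> x, \<phi> y\<rblot>\<^bsub>I.Q\<^esub>)"
    by (rule bilinear_map_comp[OF hom_lie_algebra.bracket_bilinear[OF I.Q_hom_lie] \<phi> \<phi> \<psi>])
  then have "is_star_bracket R G.Q H.Q aK bK (\<lambda>x y. \<psi> \<lblot>\<phi> x, \<phi> y\<rblot>\<^bsub>I.Q\<^esub>)"
    unfolding is_star_bracket_iff by (simp add: bracket_\<phi> \<psi>_\<phi>)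
  then interpret Q: hom_star R G.Q H.Q aK bK
    by unfold_locales (auto simp: star_defined_def)

  have "\<phi> \<in> hom_lie_hom R Q.S I.Q"
  proof (rule hom_lie_homI[OF Q.star_is_hom_lie I.Q_hom_lie \<phi>])
    fix x y assume xy: "x \<in> carrier Q.S" "y \<in> carrier Q.S"
    show "\<phi> \<lblot>x, y\<rblot>\<^bsub>Q.S\<^esub> = \<lblot>\<phi> x, \<phi> y\<rblot>\<^bsub>I.Q\<^esub>"
    \<comment> \<open>The bracket of \<open>Q.S\<close> is the one selected by \<open>SOME\<close>,
      not by definition the transported one; it is accessible through its values on generators, and
      bilinearity does the rest.\<close>
    proof (rule Q.star_ext2[OF I_mod _ _ _ xy])
      show "bilinear_map R Q.S Q.S I.Q (\<lambda>x y. \<phi> \<lblot>x, y\<rblot>\<^bsub>Q.S\<^esub>)"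
        by (rule bilinear_map_comp[OF Q.bracket_bilinear linear_map_id linear_map_id \<phi>])
      show "bilinear_map R Q.S Q.S I.Q (\<lambda>x y. \<lblot>\<phi> x, \<phi> y\<rblot>\<^bsub>I.Q\<^esub>)"
        by (rule bilinear_map_comp[OF hom_lie_algebra.bracket_bilinear[OF I.Q_hom_lie] \<phi> \<phi> linear_map_id])
    qed (simp add: Q.bracket_s bracket_\<phi>)
  next
    fix x assume x: "x \<in> carrier Q.S"
    show "\<phi> (twist Q.S x) = twist I.Q (\<phi> x)"
      by (rule Q.star_ext[OF I_mod linear_map_comp[OF Q.twist_linear \<phi>]
            linear_map_comp[OF \<phi> hom_lie_algebra.twist_linear[OF I.Q_hom_lie]] _ x])
        (auto elim!: G.Q_cases H.Q_cases
          simp: Q.twist_s G.Q_twist H.Q_twist \<phi>_s I.Q_twist GH.twist_s)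
  qed
  moreover have "bij_betw \<phi> (carrier Q.S) (carrier I.Q)"
    by (rule bij_betw_byWitness[where f' = \<psi>])
      (auto simp: \<psi>_\<phi> \<phi>_\<psi> linear_map_closed[OF \<phi>] linear_map_closed[OF \<psi>])
  ultimately show ?thesis
    unfolding hom_lie_iso_def using \<phi>_s by blast
qed

end

theorem proposition4p14:
  fixes R :: "('k, 'r) ring_scheme"
    and G H K :: "('k, 'a) hom_lie"
    and a b :: "'a \<Rightarrow> 'a \<Rightarrow> 'a"
  defines "GK \<equiv> hom_lie_quotient G (carrier K)"
    and "HK \<equiv> hom_lie_quotient H (carrier K)"
    and "aK \<equiv> quotient_action H (carrier K) a"
    and "bK \<equiv> quotient_action G (carrier K) b"
  assumes "hom_lie_algebra R G" and "hom_lie_algebra R H"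
    and "compatible_hom_actions R G H a b"
    and "hom_ideal R K G" and "hom_ideal R K H"
    and "compatible_hom_actions R K H a b"
    and "compatible_hom_actions R G K a b"
    and "compatible_hom_actions R GK HK aK bK"
    and char_two: "\<one>\<^bsub>R\<^esub> \<oplus>\<^bsub>R\<^esub> \<one>\<^bsub>R\<^esub> = \<zero>\<^bsub>R\<^esub> \<Longrightarrow>
      star_defined R G H a b \<and> star_defined R K H a b \<and> star_defined R G K a b"
  shows "(\<exists>i\<^sub>1. star_inclusion R K H G H a b i\<^sub>1) \<and>
    (\<exists>i\<^sub>2. star_inclusion R G K G H a b i\<^sub>2) \<and>
    (\<forall>i\<^sub>1 i\<^sub>2. star_inclusion R K H G H a b i\<^sub>1 \<and> star_inclusion R G K G H a b i\<^sub>2 \<longrightarrow>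
      (let GH = star R G H a b;
           K\<^sub>1 = i\<^sub>1 ` carrier (star R K H a b);
           K\<^sub>2 = i\<^sub>2 ` carrier (star R G K a b);
           I = K\<^sub>1 <+>\<^bsub>GH\<^esub> K\<^sub>2
       in hom_ideal R (GH\<lparr>carrier := K\<^sub>1\<rparr>) GH \<and> hom_ideal R (GH\<lparr>carrier := K\<^sub>2\<rparr>) GH \<and>
          (\<exists>\<phi> \<in> hom_lie_iso R (star R GK HK aK bK) (hom_lie_quotient GH I).
             \<forall>g\<in>carrier G. \<forall>h\<in>carrier H.
               \<phi> (star_elem R GK HK aK bK (carrier K +>\<^bsub>G\<^esub> g) (carrier K +>\<^bsub>H\<^esub> h))
                 = I +>\<^bsub>GH\<^esub> star_elem R G H a b g h)))"
proof -
  have K: "hom_lie_algebra R K" by (rule hom_ideal_is_hom_lie) fact+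
  have quotients: "hom_lie_algebra R GK" "hom_lie_algebra R HK"
    unfolding GK_def HK_def by (intro hom_lie_factor.Q_hom_lie hom_ideal_factor assms)+
  \<comment> \<open>In characteristic 2 the bracket comes from the assumption; otherwise 1 + 1 is
    nonzero and \<open>star_bracket_exists\<close> applies.\<close>
  have defined: "star_defined R M N a b"
    if "hom_action_pair R M N a b"
      "\<one>\<^bsub>R\<^esub> \<oplus>\<^bsub>R\<^esub> \<one>\<^bsub>R\<^esub> = \<zero>\<^bsub>R\<^esub> \<Longrightarrow> star_defined R M N a b" for M N
    using hom_action_pair.star_bracket_exists[OF that(1)] that(2) by blast
  note pairI = hom_action_pair.intro[OF _ _ hom_action_pair_axioms.intro]
  have pairs: "hom_action_pair R G H a b" "hom_action_pair R K H a b" "hom_action_pair R G K a b"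
    by (rule pairI; fact)+
  interpret star_of_quotients R G H K a b
  proof (intro star_of_quotients.intro star_of_quotients_axioms.intro
      hom_star.intro hom_star_axioms.intro pairs)
    show "hom_action_pair R (hom_lie_quotient G (carrier K)) (hom_lie_quotient H (carrier K))
        (quotient_action H (carrier K) a) (quotient_action G (carrier K) b)"
      using pairI[OF quotients] assms unfolding GK_def HK_def aK_def bK_def by blast
  qed (use defined pairs char_two assms in blast)+
  show ?thesis
    unfolding Let_def GK_def HK_def aK_def bK_def
    using inclusion_KH inclusion_GK image_KH_ideal image_GK_ideal quotient_iso by blast
qed

end
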